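(* Let $p$ be an odd prime, let $G$ be a finite $p$-group and let $V$ be a faithful $\mathbb{F}_pG$-module such that $\Omega_1(Z(G))$ contains no element that is quadratic on $V$. If $G$ satisfies either of the following conditions: (1) $G$ has nilpotence class at most four; (2) $G$ is metabelian; then $V$ is not an $F$-module.
   Context: Modules are finite-dimensional right modules, and $*$ denotes the module action. For $v\in V$, $g\in G$ put $[v,g]=v*(g-1)$. For a subspace $U$ of $V$, $[U,g]=\{[u,g] \mid u\in U\}$, and $[V,g,g]=[[V,g],g]$. A non-identity element $g\in G$ is quadratic on $V$ if $[V,g,g]=0$, i.e. $v*(g-1)^2=0$ for all $v\in V$. For $H\leq G$, $C_V(H)=\{v\in V \mid v*h=v \text{ for all } h\in H\}$ and $j_H(V)=\dfrac{|H|\,|C_V(H)|}{|V|}$. An offender of $G$ on $V$ is a non-trivial elementary abelian $p$-subgroup $E\leq G$ with $j_E(V)\geq 1$. $V$ is an $F$-module if $G$ has an offender on $V$. $\Omega_1(Z(G))$ is the subgroup of the center generated by the elements of order dividing $p$. A group is metabelian if its derived subgroup is abelian. *)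

theory Defs
  imports "HOL-Algebra.Algebra" "HOL-Number_Theory.Residues"
begin

section \<open>Groups\<close>

definition finite_p_group :: "nat \<Rightarrow> ('g, 'a) monoid_scheme \<Rightarrow> bool" where
  "finite_p_group p G \<longleftrightarrow> group G \<and> finite (carrier G) \<and> (\<exists>n. order G = p ^ n)"

definition center :: "('g, 'a) monoid_scheme \<Rightarrow> 'g set" where
  "center G = {z \<in> carrier G. \<forall>g \<in> carrier G. z \<otimes>\<^bsub>G\<^esub> g = g \<otimes>\<^bsub>G\<^esub> z}"

definition Omega1_center :: "nat \<Rightarrow> ('g, 'a) monoid_scheme \<Rightarrow> 'g set" where
  "Omega1_center p G = generate G {z \<in> center G. group.ord G z dvd p}"

definition group_commutator :: "('g, 'a) monoid_scheme \<Rightarrow> 'g \<Rightarrow> 'g \<Rightarrow> 'g" where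
  "group_commutator G x y = inv\<^bsub>G\<^esub> x \<otimes>\<^bsub>G\<^esub> inv\<^bsub>G\<^esub> y \<otimes>\<^bsub>G\<^esub> x \<otimes>\<^bsub>G\<^esub> y"

text \<open>The index is shifted by one against the usual \<open>\<gamma>\<^sub>1(G) = G\<close>, so that \<open>G\<close> has nilpotence
  class at most \<open>c\<close> iff the term with index \<open>c\<close> is trivial.\<close>

primrec lower_central :: "('g, 'a) monoid_scheme \<Rightarrow> nat \<Rightarrow> 'g set" where
  "lower_central G 0 = carrier G"
| "lower_central G (Suc n) =
     generate G {group_commutator G x y | x y. x \<in> lower_central G n \<and> y \<in> carrier G}"

definition nilpotence_class_at_most :: "('g, 'a) monoid_scheme \<Rightarrow> nat \<Rightarrow> bool" where
  "nilpotence_class_at_most G c \<longleftrightarrow> lower_central G c = {\<one>\<^bsub>G\<^esub>}"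

definition metabelian :: "('g, 'a) monoid_scheme \<Rightarrow> bool" where
  "metabelian G \<longleftrightarrow> comm_group (G\<lparr>carrier := derived G (carrier G)\<rparr>)"

definition elementary_abelian_subgroup :: "nat \<Rightarrow> ('g, 'a) monoid_scheme \<Rightarrow> 'g set \<Rightarrow> bool" where
  "elementary_abelian_subgroup p G E \<longleftrightarrow>
     subgroup E G \<and> comm_group (G\<lparr>carrier := E\<rparr>) \<and> (\<forall>x \<in> E. x [^]\<^bsub>G\<^esub> p = \<one>\<^bsub>G\<^esub>)"


section \<open>Modules\<close>

definition finite_dimensional ::
    "('k, 'a) ring_scheme \<Rightarrow> ('k, 'v, 'b) module_scheme \<Rightarrow> bool" where
  "finite_dimensional K V \<longleftrightarrow>
     (\<exists>B. finite B \<and> B \<subseteq> carrier V \<and> (\<forall>W. submodule W K V \<and> B \<subseteq> W \<longrightarrow> W = carrier V))"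

text \<open>A finite-dimensional right module over the group algebra \<open>\<bbbF>\<^sub>pG\<close>, given as an
  \<open>\<bbbF>\<^sub>p\<close>-vector space \<open>V\<close> with a linear right action \<open>act v g = v * g\<close> of \<open>G\<close>.\<close>

locale FpG_module = G: group G + V: module "residue_ring (int p)" V
  for p :: nat and G :: "('g, 'a) monoid_scheme" and V :: "(int, 'v, 'b) module_scheme" +
  fixes act :: "'v \<Rightarrow> 'g \<Rightarrow> 'v"
  assumes finite_dim: "finite_dimensional (residue_ring (int p)) V"
    and act_closed: "\<lbrakk>v \<in> carrier V; g \<in> carrier G\<rbrakk> \<Longrightarrow> act v g \<in> carrier V"
    and act_add: "\<lbrakk>u \<in> carrier V; v \<in> carrier V; g \<in> carrier G\<rbrakk>
      \<Longrightarrow> act (u \<oplus>\<^bsub>V\<^esub> v) g = act u g \<oplus>\<^bsub>V\<^esub> act v g"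
    and act_smult: "\<lbrakk>c \<in> carrier (residue_ring (int p)); v \<in> carrier V; g \<in> carrier G\<rbrakk>
      \<Longrightarrow> act (c \<odot>\<^bsub>V\<^esub> v) g = c \<odot>\<^bsub>V\<^esub> act v g"
    and act_one: "v \<in> carrier V \<Longrightarrow> act v \<one>\<^bsub>G\<^esub> = v"
    and act_mult: "\<lbrakk>v \<in> carrier V; g \<in> carrier G; h \<in> carrier G\<rbrakk>
      \<Longrightarrow> act v (g \<otimes>\<^bsub>G\<^esub> h) = act (act v g) h"

definition faithful ::
    "('g, 'a) monoid_scheme \<Rightarrow> ('k, 'v, 'b) module_scheme \<Rightarrow> ('v \<Rightarrow> 'g \<Rightarrow> 'v) \<Rightarrow> bool" where
  "faithful G V act \<longleftrightarrow>
     (\<forall>g \<in> carrier G. (\<forall>v \<in> carrier V. act v g = v) \<longrightarrow> g = \<one>\<^bsub>G\<^esub>)"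

text \<open>\<open>[v, g] = v * (g - 1)\<close> and \<open>[U, g]\<close>.\<close>

definition act_commutator ::
    "('k, 'v, 'b) module_scheme \<Rightarrow> ('v \<Rightarrow> 'g \<Rightarrow> 'v) \<Rightarrow> 'v \<Rightarrow> 'g \<Rightarrow> 'v" where
  "act_commutator V act v g = act v g \<ominus>\<^bsub>V\<^esub> v"

definition act_commutator_space ::
    "('k, 'v, 'b) module_scheme \<Rightarrow> ('v \<Rightarrow> 'g \<Rightarrow> 'v) \<Rightarrow> 'v set \<Rightarrow> 'g \<Rightarrow> 'v set" where
  "act_commutator_space V act U g = {act_commutator V act u g | u. u \<in> U}"

definition quadratic ::
    "('g, 'a) monoid_scheme \<Rightarrow> ('k, 'v, 'b) module_scheme \<Rightarrow> ('v \<Rightarrow> 'g \<Rightarrow> 'v) \<Rightarrow> 'g \<Rightarrow> bool" where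
  "quadratic G V act g \<longleftrightarrow> g \<in> carrier G \<and> g \<noteq> \<one>\<^bsub>G\<^esub> \<and>
     act_commutator_space V act (act_commutator_space V act (carrier V) g) g = {\<zero>\<^bsub>V\<^esub>}"

definition fixed_space ::
    "('k, 'v, 'b) module_scheme \<Rightarrow> ('v \<Rightarrow> 'g \<Rightarrow> 'v) \<Rightarrow> 'g set \<Rightarrow> 'v set" where
  "fixed_space V act H = {v \<in> carrier V. \<forall>h \<in> H. act v h = v}"

definition j_value ::
    "('k, 'v, 'b) module_scheme \<Rightarrow> ('v \<Rightarrow> 'g \<Rightarrow> 'v) \<Rightarrow> 'g set \<Rightarrow> real" where
  "j_value V act H =
     real (card H) * real (card (fixed_space V act H)) / real (card (carrier V))"

definition offender ::
    "nat \<Rightarrow> ('g, 'a) monoid_scheme \<Rightarrow> ('k, 'v, 'b) module_scheme \<Rightarrow> ('v \<Rightarrow> 'g \<Rightarrow> 'v) \<Rightarrow> 'g set \<Rightarrow> bool"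
  where
  "offender p G V act E \<longleftrightarrow>
     elementary_abelian_subgroup p G E \<and> E \<noteq> {\<one>\<^bsub>G\<^esub>} \<and> j_value V act E \<ge> 1"

definition F_module ::
    "nat \<Rightarrow> ('g, 'a) monoid_scheme \<Rightarrow> ('k, 'v, 'b) module_scheme \<Rightarrow> ('v \<Rightarrow> 'g \<Rightarrow> 'v) \<Rightarrow> bool" where
  "F_module p G V act \<longleftrightarrow> (\<exists>E. offender p G V act E)"

end

theory Submission
  imports Defs
begin

text \<open>Call a non-trivial elementary abelian \<open>E\<close> extremal if it maximises \<open>|E| |C\<^sub>V(E)|\<close>. A counting
  argument in the spirit of Thompson replacement shows \<open>[V, E, F] = 0\<close> for commuting minimal extremal
  \<open>E\<close> and \<open>F\<close>. If \<open>V\<close> is an \<open>F\<close>-module, the product \<open>T\<close> of a maximal family of pairwise commuting minimal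
  extremal subgroups is therefore a quadratic elementary abelian subgroup that contains each of its
  conjugates with which it commutes. On the other hand, if \<open>A\<close> is quadratic and \<open>[A, B] \<noteq> 1\<close>
  commutes with \<open>A\<close> and \<open>B\<close>, then \<open>[A, B]\<close> is quadratic. In class at most four, or in a metabelian
  group, these two properties of \<open>T\<close> produce a quadratic central element.\<close>

section \<open>Fixed points of \<open>p\<close>-groups\<close>

text \<open>The trivial group has weight |V|, so an offender is exactly a non-trivial elementary
  abelian subgroup weighing at least as much as the trivial one; hence a non-trivial subgroup of
  maximal weight exists. For commuting E, F and a vector v, the count runs over the pairs (f, c) in
  F x C_V(E), sent to [v, f] + c. It shows that C_F([v, E]) has maximal weight again, and minimality
  of F leaves only two options: this stabilizer is all of F, or it is trivial.

  Quadratic elements of T need not be central, so the obstacle is to get from T into Z(G). Two moves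
  are available. A central commutator [a, b] with a in T is quadratic of order dividing p, hence
  trivial by hypothesis. And if all [a, g] with a in T centralize T, weak closure puts them back
  into T. Both conditions on G let these moves continue until T contains a non-trivial normal
  subgroup of G, which must meet Z(G).\<close>

context group begin

lemma inv_mult_cancel: "\<lbrakk>x \<in> carrier G; y \<in> carrier G\<rbrakk> \<Longrightarrow> inv x \<otimes> (x \<otimes> y) = y"
  by (simp add: m_assoc[symmetric])

lemma mult_inv_cancel: "\<lbrakk>x \<in> carrier G; y \<in> carrier G\<rbrakk> \<Longrightarrow> x \<otimes> (inv x \<otimes> y) = y"
  by (simp add: m_assoc[symmetric])

lemmas group_simps = m_assoc inv_mult_group inv_mult_cancel mult_inv_cancel

text \<open>Orbit sizes are powers of p. Were \<open>x\<close> the only fixed point, all other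
  orbits would have size divisible by p, and |S| would be 1 modulo p.\<close>

lemma finite_p_group_fixed_point:
  assumes fin: "finite S" and p: "Factorial_Ring.prime (p::nat)" and ord: "order G = p ^ n"
    and act: "group_action G S \<phi>" and dvd: "p dvd card S" and x: "x \<in> S" "\<And>g. g \<in> carrier G \<Longrightarrow> \<phi> g x = x"
  shows "\<exists>y\<in>S. y \<noteq> x \<and> (\<forall>g\<in>carrier G. \<phi> g y = y)"
proof (rule ccontr)
  interpret group_action G S \<phi> by fact
  assume neg: "\<not> ?thesis"
  have osub: "orbit G \<phi> y \<subseteq> S" if "y \<in> S" for y
    using that element_image unfolding orbit_def by auto
  have dvdo: "p dvd card (orbit G \<phi> y)" if y: "y \<in> S" "y \<noteq> x" for y
  proof -
    have "card (orbit G \<phi> y) dvd p ^ n"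
      using orbit_stabilizer_theorem[OF y(1)] ord by (metis dvd_triv_left)
    then obtain k where k: "card (orbit G \<phi> y) = p ^ k"
      using p divides_primepow_nat by blast
    have "k \<noteq> 0"
    proof
      assume "k = 0"
      then have "card (orbit G \<phi> y) = 1" using k by simp
      then obtain z where z: "orbit G \<phi> y = {z}" using card_1_singletonE by blast
      have "\<phi> g y = y" if "g \<in> carrier G" for g
      proof -
        have "\<phi> g y \<in> orbit G \<phi> y" using that by (auto simp: orbit_def)
        moreover have "y \<in> orbit G \<phi> y" using y(1) orbit_refl by blast
        ultimately show ?thesis using z by simp
      qed
      then show False using neg y by blast
    qed
    then show ?thesis using k by simp
  qed
  have ox: "orbit G \<phi> x = {x}" using x by (auto simp: orbit_def intro: exI[of _ \<one>])
  have finO: "finite (orbits G S \<phi>)" unfolding orbits_def using fin by simp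
  have xO: "orbit G \<phi> x \<in> orbits G S \<phi>" using x by (auto simp: orbits_def)
  have "card S = (\<Sum>W\<in>orbits G S \<phi>. card W)"
  proof -
    have "card (\<Union>(orbits G S \<phi>)) = sum card (orbits G S \<phi>)"
      by (rule card_Union_disjoint) (use disjoint_union finite_subset[OF osub fin] in \<open>auto simp: orbits_def pairwise_def disjnt_def\<close>)
    then show ?thesis using orbits_coverture by simp
  qed
  also have "\<dots> = 1 + (\<Sum>W\<in>orbits G S \<phi> - {{x}}. card W)"
    using finO xO ox by (subst sum.remove[of _ "{x}"]) auto
  finally have "card S = 1 + (\<Sum>W\<in>orbits G S \<phi> - {{x}}. card W)" .
  moreover have "p dvd (\<Sum>W\<in>orbits G S \<phi> - {{x}}. card W)"
  proof (rule dvd_sum)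
    fix W assume "W \<in> orbits G S \<phi> - {{x}}"
    then obtain y where "y \<in> S" "W = orbit G \<phi> y" "W \<noteq> {x}" by (auto simp: orbits_def)
    then show "p dvd card W" using dvdo ox by metis
  qed
  ultimately have "p dvd 1" using dvd by (metis dvd_add_left_iff)
  then show False using p by auto
qed

text \<open>Bijectivity comes from the inverse map \<open>f (inv g)\<close>; \<open>restrict\<close>
  is there because \<open>Bij\<close> contains only functions that are extensional on
  \<open>S\<close>.\<close>

lemma group_actionI:
  assumes "\<And>g x. g \<in> carrier G \<Longrightarrow> x \<in> S \<Longrightarrow> f g x \<in> S"
    and "\<And>x. x \<in> S \<Longrightarrow> f \<one> x = x"
    and "\<And>g h x. g \<in> carrier G \<Longrightarrow> h \<in> carrier G \<Longrightarrow> x \<in> S \<Longrightarrow> f (g \<otimes> h) x = f g (f h x)"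
  shows "group_action G S (\<lambda>g. restrict (f g) S)"
proof -
  have inv: "f (inv g) (f g x) = x" "f g (f (inv g) x) = x" if "g \<in> carrier G" "x \<in> S" for g x
    using that assms(2) assms(3)[of "inv g" g x] assms(3)[of g "inv g" x] by auto
  have bij: "restrict (f g) S \<in> Bij S" if "g \<in> carrier G" for g
    unfolding Bij_def using that
    by (auto intro!: bij_betwI[where g = "f (inv g)"] simp: assms(1) inv)
  show ?thesis
    unfolding group_action_def group_hom_def group_hom_axioms_def hom_def
    using bij group_BijGroup[of S]
    by (auto simp: is_group BijGroup_def compose_def assms fun_eq_iff)
qed

text \<open>The non-trivial normal subgroup N/C of the p-group G/C meets the centre. Instead of
  passing to the quotient, G acts by conjugation on the cosets of C in N; their number is divisible
  by p and C is a fixed point, so there is a second one.\<close>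

lemma finite_p_group_ex_central_mod:
  assumes p: "Factorial_Ring.prime (p::nat)" and ord: "order G = p ^ n" and fin: "finite (carrier G)"
    and C: "C \<lhd> G" and N: "N \<lhd> G" and CN: "C \<subset> N"
  shows "\<exists>b\<in>N - C. \<forall>g\<in>carrier G. inv b \<otimes> (inv g \<otimes> b \<otimes> g) \<in> C"
proof -
  interpret C: normal C G by fact
  interpret N: normal N G by fact
  have Cs: "C \<subseteq> carrier G" and Ns: "N \<subseteq> carrier G" using C.subset N.subset .
  interpret GN: group "G\<lparr>carrier := N\<rparr>" by (rule N.subgroup_is_group[OF is_group])
  have CsN: "subgroup C (G\<lparr>carrier := N\<rparr>)"
    by (rule subgroup_incl) (use CN C.subgroup_axioms N.subgroup_axioms in auto)
  define S where "S = rcosets\<^bsub>G\<lparr>carrier := N\<rparr>\<^esub> C"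
  have Sdef: "S = {C #> n | n. n \<in> N}"
    unfolding S_def RCOSETS_def r_coset_def by auto
  define f where "f g K = (\<lambda>k. g \<otimes> k \<otimes> inv g) ` K" for g K
  have f_coset: "f g (C #> x) = C #> (g \<otimes> x \<otimes> inv g)" if "g \<in> carrier G" "x \<in> carrier G" for g x
  proof -
    have *: "g \<otimes> (c \<otimes> x) \<otimes> inv g = (g \<otimes> c \<otimes> inv g) \<otimes> (g \<otimes> x \<otimes> inv g)" if "c \<in> C" for c
      using that \<open>g \<in> _\<close> \<open>x \<in> _\<close> Cs by (simp add: group_simps subset_iff)
    have im: "(\<lambda>c. g \<otimes> c \<otimes> inv g) ` C = C"
    proof
      show "(\<lambda>c. g \<otimes> c \<otimes> inv g) ` C \<subseteq> C" using that C.inv_op_closed2 by auto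
      show "C \<subseteq> (\<lambda>c. g \<otimes> c \<otimes> inv g) ` C"
      proof
        fix c assume c: "c \<in> C"
        then have "c = g \<otimes> (inv g \<otimes> c \<otimes> g) \<otimes> inv g" using that Cs by (simp add: group_simps subset_iff)
        then show "c \<in> (\<lambda>c. g \<otimes> c \<otimes> inv g) ` C" using C.inv_op_closed1[OF that(1) c] by blast
      qed
    qed
    have "f g (C #> x) = (\<lambda>d. d \<otimes> (g \<otimes> x \<otimes> inv g)) ` ((\<lambda>c. g \<otimes> c \<otimes> inv g) ` C)"
      unfolding f_def r_coset_def using * by (auto simp: image_iff)
    then show ?thesis unfolding im by (auto simp: r_coset_def)
  qed
  have act: "group_action G S (\<lambda>g. restrict (f g) S)"
  proof (rule group_actionI)
    show "f g x \<in> S" if "g \<in> carrier G" "x \<in> S" for g x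
      using that Ns N.inv_op_closed2 f_coset unfolding Sdef by (auto simp: subset_iff)
    show "f \<one> x = x" if "x \<in> S" for x
      using that Ns f_coset unfolding Sdef by (auto simp: subset_iff)
    show "f (g \<otimes> h) x = f g (f h x)" if "g \<in> carrier G" "h \<in> carrier G" "x \<in> S" for g h x
      using that Ns f_coset unfolding Sdef by (auto simp: subset_iff inv_mult_group m_assoc)
  qed
  have finN: "finite N" using fin Ns finite_subset by blast
  have finX: "finite S" unfolding Sdef using finN by simp
  have cardX: "card S * card C = card N"
    using GN.lagrange[OF CsN] unfolding S_def order_def by simp
  have "card S dvd p ^ n"
  proof -
    have "card N dvd p ^ n" using lagrange[OF N.subgroup_axioms] ord by (metis dvd_triv_right)
    then show ?thesis using cardX by (metis dvd_mult_left)
  qed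
  then obtain k where k: "card S = p ^ k" using p divides_primepow_nat by blast
  have "k \<noteq> 0"
  proof
    assume "k = 0"
    then have "card C = card N" using k cardX by simp
    then show False using psubset_card_mono[OF finN CN] by simp
  qed
  then have dvdX: "p dvd card S" using k by simp
  have CX: "C \<in> S" unfolding Sdef using coset_mult_one[OF Cs] N.one_closed by force
  have fixC: "restrict (f g) S C = C" if "g \<in> carrier G" for g
    using f_coset[OF that, of \<one>] that CX coset_mult_one[OF Cs] by simp
  obtain Y where Y: "Y \<in> S" "Y \<noteq> C" "\<And>g. g \<in> carrier G \<Longrightarrow> f g Y = Y"
    using finite_p_group_fixed_point[OF finX p ord act dvdX CX fixC] by auto
  then obtain b where b: "b \<in> N" "Y = C #> b" unfolding Sdef by blast
  have bG: "b \<in> carrier G" using b Ns by auto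
  have "b \<notin> C" using b Y(2) C.rcos_const[OF is_group] by blast
  moreover have "inv b \<otimes> (inv g \<otimes> b \<otimes> g) \<in> C" if g: "g \<in> carrier G" for g
  proof -
    \<comment> \<open>\<open>f g\<close> conjugates as g k g^-1, so the fixed coset is tested at
      \<open>inv g\<close>.\<close>
    have "C #> (inv g \<otimes> b \<otimes> g) = C #> b"
      using Y(3)[of "inv g"] f_coset[of "inv g" b] g bG b by simp
    then have "inv g \<otimes> b \<otimes> g \<in> C #> b"
      using g bG by (metis C.subgroup_axioms inv_closed m_closed rcos_self)
    then obtain c where c: "c \<in> C" "inv g \<otimes> b \<otimes> g = c \<otimes> b" unfolding r_coset_def by auto
    then have "inv b \<otimes> (inv g \<otimes> b \<otimes> g) = inv b \<otimes> c \<otimes> b" using bG Cs by (auto simp: m_assoc)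
    then show ?thesis using C.inv_op_closed1[OF bG c(1)] by simp
  qed
  ultimately show ?thesis using b by auto
qed

end

section \<open>Commuting minimal extremal subgroups\<close>

text \<open>The library sets up the method \<open>algebra\<close> for rings only.\<close>

lemmas (in abelian_group) abelian_group_simprules
  [algebra abelian_group "ring.zero G" "ring.add G" "a_inv G" "a_minus G"] =
  a_closed zero_closed a_inv_closed minus_closed
  a_assoc l_zero l_neg a_comm minus_eq r_zero r_neg r_neg2 r_neg1 minus_add minus_minus minus_zero
  a_lcomm

lemma (in abelian_group) minus_eq_minus_iff:
  assumes "a \<in> carrier G" "b \<in> carrier G" "c \<in> carrier G" "d \<in> carrier G"
  shows "a \<ominus> b = c \<ominus> d \<longleftrightarrow> a \<oplus> d = c \<oplus> b"
proof -
  have 1: "(a \<ominus> b) \<oplus> (b \<oplus> d) = a \<oplus> d" "(c \<ominus> d) \<oplus> (b \<oplus> d) = c \<oplus> b"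
    using assms by (algebra, algebra)
  show ?thesis
    using assms add.right_cancel[of "b \<oplus> d" "a \<ominus> b" "c \<ominus> d"] 1 by simp
qed

lemma (in abelian_group) minus_eq_zero_iff:
  "\<lbrakk>a \<in> carrier G; b \<in> carrier G\<rbrakk> \<Longrightarrow> a \<ominus> b = \<zero> \<longleftrightarrow> a = b"
  using minus_eq_minus_iff[of a b b b] by (simp add: minus_eq r_neg)

lemma nat_factors_eq_if_le:
  fixes a b n :: nat
  assumes "a \<le> n" "b \<le> n" "a * b = n * n" "0 < n"
  shows "a = n"
proof (rule ccontr)
  assume "a \<noteq> n"
  then have "a < n" using assms by simp
  then have "a * n < n * n" using assms(4) by (rule mult_less_mono1)
  moreover have "a * b \<le> a * n" using assms(2) by (rule mult_le_mono2)
  ultimately show False using assms by simp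
qed

text \<open>Finiteness of V is an assumption here; in the final theorem it follows from the
  existence of an offender.\<close>

locale p_group_module = FpG_module p G V act
  for p :: nat and G :: "('g, 'a) monoid_scheme" (structure)
    and V :: "(int, 'v, 'b) module_scheme" (structure) and act :: "'v \<Rightarrow> 'g \<Rightarrow> 'v" +
  assumes prime_p: "Factorial_Ring.prime p" and p_group: "finite_p_group p G"
    and finite_V: "finite (carrier V)"
begin

abbreviation fixed :: "'g set \<Rightarrow> 'v set" where
  "fixed \<equiv> fixed_space V act"

text \<open>\<open>[V, E, F] = 0\<close>, phrased without the span of the commutators.\<close>

definition acts_trivially :: "'g set \<Rightarrow> 'g set \<Rightarrow> bool" where
  "acts_trivially E F \<longleftrightarrow>
     (\<forall>v\<in>carrier V. \<forall>e\<in>E. \<forall>f\<in>F. act (act v e \<ominus>\<^bsub>V\<^esub> v) f = act v e \<ominus>\<^bsub>V\<^esub> v)"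

definition commuting :: "'g set \<Rightarrow> 'g set \<Rightarrow> bool" where
  "commuting E F \<longleftrightarrow> (\<forall>e\<in>E. \<forall>f\<in>F. e \<otimes> f = f \<otimes> e)"

definition weight :: "'g set \<Rightarrow> nat" where
  "weight E = card E * card (fixed E)"

section \<open>Elementary properties of the action\<close>

lemma finite_G: "finite (carrier G)" using p_group by (simp add: finite_p_group_def)

lemma order_eq: "\<exists>n. order G = p ^ n" using p_group by (simp add: finite_p_group_def)

lemma act_zero: "g \<in> carrier G \<Longrightarrow> act \<zero>\<^bsub>V\<^esub> g = \<zero>\<^bsub>V\<^esub>"
  using act_add[of "\<zero>\<^bsub>V\<^esub>" "\<zero>\<^bsub>V\<^esub>" g] act_closed[of "\<zero>\<^bsub>V\<^esub>" g]
  by (simp add: V.M.add.l_cancel_one')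

lemma act_uminus: "\<lbrakk>v \<in> carrier V; g \<in> carrier G\<rbrakk> \<Longrightarrow> act (\<ominus>\<^bsub>V\<^esub> v) g = \<ominus>\<^bsub>V\<^esub> act v g"
  using act_add[of "\<ominus>\<^bsub>V\<^esub> v" v g] act_zero[of g]
  by (simp add: V.M.l_neg V.M.minus_equality act_closed)

lemma act_minus: "\<lbrakk>u \<in> carrier V; v \<in> carrier V; g \<in> carrier G\<rbrakk>
    \<Longrightarrow> act (u \<ominus>\<^bsub>V\<^esub> v) g = act u g \<ominus>\<^bsub>V\<^esub> act v g"
  by (simp add: V.M.minus_eq act_add act_uminus)

lemma act_inv: "\<lbrakk>v \<in> carrier V; g \<in> carrier G\<rbrakk> \<Longrightarrow> act (act v g) (inv g) = v"
  "\<lbrakk>v \<in> carrier V; g \<in> carrier G\<rbrakk> \<Longrightarrow> act (act v (inv g)) g = v"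
  by (simp_all add: act_mult[symmetric] act_one)

lemma act_inj: "\<lbrakk>u \<in> carrier V; v \<in> carrier V; g \<in> carrier G; act u g = act v g\<rbrakk> \<Longrightarrow> u = v"
  by (metis act_inv(1))

lemma act_commute: "\<lbrakk>v \<in> carrier V; e \<in> carrier G; f \<in> carrier G; e \<otimes> f = f \<otimes> e\<rbrakk>
    \<Longrightarrow> act (act v e) f = act (act v f) e"
  by (metis act_mult)

lemma act_commutator_fixed_iff:
  assumes "v \<in> carrier V" "e \<in> carrier G" "f \<in> carrier G"
  shows "act (act v e \<ominus>\<^bsub>V\<^esub> v) f = act v e \<ominus>\<^bsub>V\<^esub> v \<longleftrightarrow>
    act (act v e) f \<oplus>\<^bsub>V\<^esub> v = act v e \<oplus>\<^bsub>V\<^esub> act v f"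
  using assms by (simp add: act_minus act_closed V.M.minus_eq_minus_iff)

text \<open>The subtraction-free form v*e*f + v = v*e + v*f of [v, e, f] = 0 is symmetric in
  commuting e and f.\<close>

lemma act_commutator_fixed_commute:
  assumes "v \<in> carrier V" "e \<in> carrier G" "f \<in> carrier G" "e \<otimes> f = f \<otimes> e"
  shows "act (act v e \<ominus>\<^bsub>V\<^esub> v) f = act v e \<ominus>\<^bsub>V\<^esub> v \<longleftrightarrow>
    act (act v f \<ominus>\<^bsub>V\<^esub> v) e = act v f \<ominus>\<^bsub>V\<^esub> v"
  using assms act_commute[OF assms] by (simp add: act_commutator_fixed_iff V.M.a_comm act_closed)

lemma fixed_subset: "fixed E \<subseteq> carrier V"
  by (auto simp: fixed_space_def)

lemma finite_fixed: "finite (fixed E)"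
  using fixed_subset finite_V finite_subset by blast

lemma fixed_one: "fixed {\<one>} = carrier V"
  by (auto simp: fixed_space_def act_one)

lemma elementary_iff: "elementary_abelian_subgroup p G E \<longleftrightarrow>
    subgroup E G \<and> commuting E E \<and> (\<forall>x\<in>E. x [^] p = \<one>)"
proof -
  have "comm_group (G\<lparr>carrier := E\<rparr>) \<longleftrightarrow> commuting E E" if E: "subgroup E G"
  proof
    assume "comm_group (G\<lparr>carrier := E\<rparr>)"
    then interpret comm_group "G\<lparr>carrier := E\<rparr>" .
    show "commuting E E" using m_comm by (auto simp: commuting_def)
  next
    assume "commuting E E"
    then show "comm_group (G\<lparr>carrier := E\<rparr>)"
      using G.subgroup_imp_group[OF E] by (auto simp: commuting_def intro!: group.group_comm_groupI)
  qed
  then show ?thesis by (auto simp: elementary_abelian_subgroup_def)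
qed

lemma elementary_subgroup:
  assumes "elementary_abelian_subgroup p G E" "subgroup F G" "F \<subseteq> E"
  shows "elementary_abelian_subgroup p G F"
  using assms by (auto simp: elementary_iff commuting_def)

lemma elementary_one: "elementary_abelian_subgroup p G {\<one>}"
  using G.triv_subgroup by (auto simp: elementary_iff commuting_def)

section \<open>Counting translates of commutators\<close>

lemma subgroup_stabilizing:
  assumes "subgroup F G" "W \<subseteq> carrier V"
  shows "subgroup {f \<in> F. \<forall>w\<in>W. act w f = w} G"
proof -
  interpret F: subgroup F G by fact
  show ?thesis
  proof (rule G.subgroupI)
    have "\<one> \<in> {f \<in> F. \<forall>w\<in>W. act w f = w}"
      using assms(2) F.one_closed act_one by blast
    then show "{f \<in> F. \<forall>w\<in>W. act w f = w} \<noteq> {}" by blast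
    fix a assume "a \<in> {f \<in> F. \<forall>w\<in>W. act w f = w}"
    then show "inv a \<in> {f \<in> F. \<forall>w\<in>W. act w f = w}"
      using act_inv(1)[of _ a] assms(2) F.subset by (auto simp: subset_iff) metis
  next
    fix a b assume "a \<in> {f \<in> F. \<forall>w\<in>W. act w f = w}" "b \<in> {f \<in> F. \<forall>w\<in>W. act w f = w}"
    then show "a \<otimes> b \<in> {f \<in> F. \<forall>w\<in>W. act w f = w}"
      using act_mult[of _ a b] assms(2) F.subset by (auto simp: subset_iff)
  qed (use F.subset in auto)
qed

text \<open>For h in F, d in C_V(E) and u = [v, h] + d one has [v, e]*h = [u, e] + [v, e], because e
  commutes with h and fixes d. So the effect of h on [v, e] depends on u alone, and two pairs with
  the same u act alike on [v, E].\<close>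

lemma commutator_translate_eq:
  assumes EF: "E \<subseteq> carrier G" "subgroup F G" "commuting E F" and v: "v \<in> carrier V"
    and f: "f \<in> F" "f' \<in> F" and c: "c \<in> fixed E" "c' \<in> fixed E"
    and eq: "(act v f \<ominus>\<^bsub>V\<^esub> v) \<oplus>\<^bsub>V\<^esub> c = (act v f' \<ominus>\<^bsub>V\<^esub> v) \<oplus>\<^bsub>V\<^esub> c'"
    and e: "e \<in> E"
  shows "act (act v e \<ominus>\<^bsub>V\<^esub> v) (f \<otimes> inv f') = act v e \<ominus>\<^bsub>V\<^esub> v"
proof -
  interpret F: subgroup F G by fact
  have eG: "e \<in> carrier G" and fG: "f \<in> carrier G" "f' \<in> carrier G" using EF e f by auto
  have cV: "c \<in> carrier V" "c' \<in> carrier V" using c fixed_subset by auto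
  have *: "act (act v e \<ominus>\<^bsub>V\<^esub> v) h = (act u e \<ominus>\<^bsub>V\<^esub> u) \<oplus>\<^bsub>V\<^esub> (act v e \<ominus>\<^bsub>V\<^esub> v)"
    if h: "h \<in> F" and d: "d \<in> fixed E" and u: "u = (act v h \<ominus>\<^bsub>V\<^esub> v) \<oplus>\<^bsub>V\<^esub> d" for h d u
  proof -
    have hG: "h \<in> carrier G" and dV: "d \<in> carrier V" using h d fixed_subset by auto
    have de: "act d e = d" using d e by (auto simp: fixed_space_def)
    have comm: "act (act v e) h = act (act v h) e"
      using act_commute[OF v eG hG] EF(3) e h unfolding commuting_def by blast
    have ue: "act u e = (act (act v h) e \<ominus>\<^bsub>V\<^esub> act v e) \<oplus>\<^bsub>V\<^esub> d"
      unfolding u using v eG hG dV de by (simp add: act_add act_minus act_closed)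
    have cl: "act (act v h) e \<in> carrier V" "act v e \<in> carrier V" "act v h \<in> carrier V"
      using v eG hG act_closed by auto
    have "act (act v e \<ominus>\<^bsub>V\<^esub> v) h = act (act v h) e \<ominus>\<^bsub>V\<^esub> act v h"
      using v eG hG by (simp add: act_minus act_closed comm)
    also have "\<dots> = (act u e \<ominus>\<^bsub>V\<^esub> u) \<oplus>\<^bsub>V\<^esub> (act v e \<ominus>\<^bsub>V\<^esub> v)"
      unfolding ue unfolding u using cl v dV by algebra
    finally show ?thesis .
  qed
  have "act (act v e \<ominus>\<^bsub>V\<^esub> v) f = act (act v e \<ominus>\<^bsub>V\<^esub> v) f'"
    using *[OF f(1) c(1) refl] *[OF f(2) c(2) refl] eq by simp
  moreover have "act v e \<ominus>\<^bsub>V\<^esub> v \<in> carrier V" using v eG act_closed by auto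
  ultimately show ?thesis using fG by (simp add: act_mult act_inv(1))
qed

lemma commuting_sym: "commuting E F \<Longrightarrow> commuting F E"
  by (auto simp: commuting_def)

lemma act_commutator_closed:
  "\<lbrakk>v \<in> carrier V; g \<in> carrier G\<rbrakk> \<Longrightarrow> act v g \<ominus>\<^bsub>V\<^esub> v \<in> carrier V"
  using act_closed by simp

text \<open>\<open>C\<^sub>F([v, E])\<close>\<close>

definition commutator_stabilizer :: "'g set \<Rightarrow> 'g set \<Rightarrow> 'v \<Rightarrow> 'g set" where
  "commutator_stabilizer E F v =
     {f \<in> F. \<forall>w\<in>{act v e \<ominus>\<^bsub>V\<^esub> v | e. e \<in> E}. act w f = w}"

lemma commutator_stabilizer_subgroup:
  assumes "E \<subseteq> carrier G" "subgroup F G" "v \<in> carrier V"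
  shows "subgroup (commutator_stabilizer E F v) G"
  unfolding commutator_stabilizer_def
  by (rule subgroup_stabilizing) (use assms act_commutator_closed in auto)

lemma commutator_translate_in_fixed:
  assumes E: "E \<subseteq> carrier G" and F: "F \<subseteq> carrier G" and v: "v \<in> carrier V"
    and f: "f \<in> F" and c: "c \<in> fixed E"
  shows "(act v f \<ominus>\<^bsub>V\<^esub> v) \<oplus>\<^bsub>V\<^esub> c \<in> fixed (commutator_stabilizer F E v)"
proof -
  have cV: "c \<in> carrier V" and fG: "f \<in> carrier G" using c f F fixed_subset by auto
  have dV: "act v f \<ominus>\<^bsub>V\<^esub> v \<in> carrier V" using act_commutator_closed[OF v fG] .
  have "act ((act v f \<ominus>\<^bsub>V\<^esub> v) \<oplus>\<^bsub>V\<^esub> c) e = (act v f \<ominus>\<^bsub>V\<^esub> v) \<oplus>\<^bsub>V\<^esub> c"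
    if "e \<in> commutator_stabilizer F E v" for e
  proof -
    have e: "e \<in> E" "act (act v f \<ominus>\<^bsub>V\<^esub> v) e = act v f \<ominus>\<^bsub>V\<^esub> v"
      using that f by (auto simp: commutator_stabilizer_def)
    have "act c e = c" using c e(1) by (auto simp: fixed_space_def)
    then show ?thesis using act_add[OF dV cV] e E by auto
  qed
  then show ?thesis using dV cV by (simp add: fixed_space_def)
qed

lemma commutator_translate_inj:
  assumes E: "E \<subseteq> carrier G" and F: "subgroup F G" and EF: "commuting E F" and v: "v \<in> carrier V"
    and triv: "commutator_stabilizer E F v = {\<one>}"
  shows "inj_on (\<lambda>(f, c). (act v f \<ominus>\<^bsub>V\<^esub> v) \<oplus>\<^bsub>V\<^esub> c) (F \<times> fixed E)"
proof (rule inj_onI, clarify)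
  interpret F: subgroup F G by fact
  fix f c f' c' assume f: "f \<in> F" "f' \<in> F" and c: "c \<in> fixed E" "c' \<in> fixed E"
    and eq: "(act v f \<ominus>\<^bsub>V\<^esub> v) \<oplus>\<^bsub>V\<^esub> c = (act v f' \<ominus>\<^bsub>V\<^esub> v) \<oplus>\<^bsub>V\<^esub> c'"
  have "f \<otimes> inv f' \<in> commutator_stabilizer E F v"
    using commutator_translate_eq[OF E F EF v f c eq] f by (auto simp: commutator_stabilizer_def)
  then have "f \<otimes> inv f' = \<one>" using triv by simp
  then have "f = f'" using f by (simp add: G.inv_solve_right' F.mem_carrier)
  moreover have "c \<in> carrier V" "c' \<in> carrier V" using c fixed_subset by auto
  ultimately show "f = f' \<and> c = c'"
    using eq act_commutator_closed[OF v F.mem_carrier[OF f(1)]] by simp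
qed

text \<open>In a fibre of (f, c) |-> [v, f] + c, the entry f is determined up to C_F([v, E]), and c
  is then determined by f. So each fibre has at most |C_F([v, E])| elements, while all values are
  fixed by C_E([v, F]).\<close>

lemma card_commutator_stabilizer:
  assumes E: "E \<subseteq> carrier G" and F: "subgroup F G" and EF: "commuting E F" and v: "v \<in> carrier V"
  shows "card F * card (fixed E) \<le>
    card (commutator_stabilizer E F v) * card (fixed (commutator_stabilizer F E v))"
proof -
  interpret F: subgroup F G by fact
  define \<theta> where "\<theta> f c = (act v f \<ominus>\<^bsub>V\<^esub> v) \<oplus>\<^bsub>V\<^esub> c" for f c
  \<comment> \<open>\<open>r u\<close> selects the F-entry of one pair in the fibre over
    \<open>u\<close>; dividing by it turns the bound on fibres into an injection.\<close>
  define r where "r u = (SOME f. f \<in> F \<and> (\<exists>c\<in>fixed E. \<theta> f c = u))" for u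
  have r: "r (\<theta> f c) \<in> F \<and> (\<exists>c'\<in>fixed E. \<theta> (r (\<theta> f c)) c' = \<theta> f c)" if "f \<in> F" "c \<in> fixed E" for f c
    unfolding r_def by (rule someI[of _ f]) (use that in blast)
  have mem: "f \<otimes> inv (r (\<theta> f c)) \<in> commutator_stabilizer E F v"
    if f: "f \<in> F" and c: "c \<in> fixed E" for f c
  proof -
    have rF: "r (\<theta> f c) \<in> F" using r[OF f c] ..
    have "\<exists>c'\<in>fixed E. \<theta> (r (\<theta> f c)) c' = \<theta> f c" using r[OF f c] ..
    then obtain c' where c': "c' \<in> fixed E" "\<theta> (r (\<theta> f c)) c' = \<theta> f c" ..
    have "act (act v e \<ominus>\<^bsub>V\<^esub> v) (f \<otimes> inv (r (\<theta> f c))) = act v e \<ominus>\<^bsub>V\<^esub> v" if "e \<in> E" for e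
      by (rule commutator_translate_eq[OF E F EF v f rF c c'(1) _ that])
        (use c'(2) in \<open>simp add: \<theta>_def\<close>)
    then show ?thesis using f rF by (auto simp: commutator_stabilizer_def)
  qed
  have "inj_on (\<lambda>(f, c). (f \<otimes> inv (r (\<theta> f c)), \<theta> f c)) (F \<times> fixed E)"
  proof (rule inj_onI, clarify)
    fix f c f' c' assume f: "f \<in> F" "f' \<in> F" and c: "c \<in> fixed E" "c' \<in> fixed E"
      and eq: "f \<otimes> inv (r (\<theta> f c)) = f' \<otimes> inv (r (\<theta> f' c'))" "\<theta> f c = \<theta> f' c'"
    have "f = f'" using eq f r[OF f(2) c(2)] by auto
    moreover have "c \<in> carrier V" "c' \<in> carrier V" using c fixed_subset by auto
    ultimately show "f = f' \<and> c = c'"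
      using eq(2) act_commutator_closed[OF v F.mem_carrier[OF f(1)]] by (simp add: \<theta>_def)
  qed
  moreover have "(\<lambda>(f, c). (f \<otimes> inv (r (\<theta> f c)), \<theta> f c)) ` (F \<times> fixed E)
      \<subseteq> commutator_stabilizer E F v \<times> fixed (commutator_stabilizer F E v)"
    using mem commutator_translate_in_fixed[OF E F.subset v] by (auto simp: \<theta>_def)
  moreover have "finite (commutator_stabilizer E F v \<times> fixed (commutator_stabilizer F E v))"
    using finite_fixed finite_subset[OF F.subset finite_G] by (simp add: commutator_stabilizer_def)
  ultimately have "card (F \<times> fixed E)
      \<le> card (commutator_stabilizer E F v \<times> fixed (commutator_stabilizer F E v))"
    by (rule card_inj_on_le)
  then show ?thesis by (simp add: card_cartesian_product)
qed

section \<open>Extremal subgroups\<close>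

definition max_weight :: nat where
  "max_weight = Max (weight ` {E. elementary_abelian_subgroup p G E})"

text \<open>The trivial subgroup takes part in the maximum and is excluded only here. It may itself
  attain the maximum, namely |V|; that is the delicate case in the replacement argument.\<close>

definition extremal :: "'g set \<Rightarrow> bool" where
  "extremal E \<longleftrightarrow> elementary_abelian_subgroup p G E \<and> E \<noteq> {\<one>} \<and> weight E = max_weight"

definition minimal_extremal :: "'g set \<Rightarrow> bool" where
  "minimal_extremal E \<longleftrightarrow> extremal E \<and> (\<forall>F. extremal F \<and> F \<subseteq> E \<longrightarrow> F = E)"

lemma finite_elementary: "finite {E. elementary_abelian_subgroup p G E}"
  by (rule finite_subset[of _ "Pow (carrier G)"])
    (use finite_G in \<open>auto simp: elementary_iff dest: subgroup.subset\<close>)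

lemma weight_le: "elementary_abelian_subgroup p G E \<Longrightarrow> weight E \<le> max_weight"
  unfolding max_weight_def using finite_elementary by (auto intro!: Max_ge)

lemma weight_one: "weight {\<one>} = card (carrier V)"
  by (simp add: weight_def fixed_one)

lemma max_weight_pos: "0 < max_weight"
proof -
  have "0 < card (carrier V)" using finite_V V.M.zero_closed by (auto simp: card_gt_0_iff)
  then show ?thesis using weight_le[OF elementary_one] by (simp add: weight_one)
qed

text \<open>Multiplying the two counting inequalities for (E, F) and (F, E) regroups into weight E *
  weight F <= weight F' * weight E' for the two stabilizers F' and E'. As no factor exceeds the
  maximum, it is attained by both.\<close>

lemma commutator_stabilizer_weight:
  assumes E: "elementary_abelian_subgroup p G E" and F: "elementary_abelian_subgroup p G F"
    and comm: "commuting E F" and v: "v \<in> carrier V"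
    and wE: "weight E = max_weight" and wF: "weight F = max_weight"
  shows "weight (commutator_stabilizer E F v) = max_weight"
proof -
  let ?F = "commutator_stabilizer E F v" and ?E = "commutator_stabilizer F E v"
  have sE: "subgroup E G" and sF: "subgroup F G" using E F by (auto simp: elementary_iff)
  have Es: "E \<subseteq> carrier G" and Fs: "F \<subseteq> carrier G" using sE sF by (auto dest: subgroup.subset)
  have F1: "elementary_abelian_subgroup p G ?F"
    by (rule elementary_subgroup[OF F commutator_stabilizer_subgroup[OF Es sF v]])
      (auto simp: commutator_stabilizer_def)
  have E1: "elementary_abelian_subgroup p G ?E"
    by (rule elementary_subgroup[OF E commutator_stabilizer_subgroup[OF Fs sE v]])
      (auto simp: commutator_stabilizer_def)
  have "card F * card (fixed E) \<le> card ?F * card (fixed ?E)"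
    by (rule card_commutator_stabilizer[OF Es sF comm v])
  moreover have "card E * card (fixed F) \<le> card ?E * card (fixed ?F)"
    by (rule card_commutator_stabilizer[OF Fs sE commuting_sym[OF comm] v])
  ultimately have "(card F * card (fixed E)) * (card E * card (fixed F))
      \<le> (card ?F * card (fixed ?E)) * (card ?E * card (fixed ?F))"
    by (rule mult_le_mono)
  then have "weight E * weight F \<le> weight ?F * weight ?E"
    by (simp add: weight_def ac_simps)
  then have "max_weight * max_weight \<le> weight ?F * weight ?E"
    by (simp only: wE wF)
  also have "\<dots> \<le> weight ?F * max_weight" using weight_le[OF E1] by simp
  finally have "max_weight \<le> weight ?F" using max_weight_pos by simp
  then show ?thesis using weight_le[OF F1] by simp
qed

text \<open>If the stabilizer were trivial, then \<open>(f, c) \<mapsto> [v, f] + c\<close> would be a bijection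
  \<open>F \<times> C\<^sub>V(E) \<rightarrow> V\<close>; a preimage of \<open>-v\<close> yields \<open>v * f \<in> C\<^sub>V(E)\<close>, hence \<open>v \<in> C\<^sub>V(E)\<close>.\<close>

lemma minimal_extremal_acts_trivially:
  assumes E: "minimal_extremal E" and F: "minimal_extremal F" and comm: "commuting E F"
  shows "acts_trivially E F"
proof (rule ccontr)
  assume "\<not> ?thesis"
  then obtain v e0 f0 where v: "v \<in> carrier V" and e0: "e0 \<in> E" and f0: "f0 \<in> F"
    and ne: "act (act v e0 \<ominus>\<^bsub>V\<^esub> v) f0 \<noteq> act v e0 \<ominus>\<^bsub>V\<^esub> v"
    unfolding acts_trivially_def by blast
  let ?F = "commutator_stabilizer E F v" and ?E = "commutator_stabilizer F E v"
  have eE: "elementary_abelian_subgroup p G E" and eF: "elementary_abelian_subgroup p G F"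
    and wE: "weight E = max_weight" and wF: "weight F = max_weight"
    using E F by (auto simp: minimal_extremal_def extremal_def)
  have sE: "subgroup E G" and sF: "subgroup F G" using eE eF by (auto simp: elementary_iff)
  interpret E: subgroup E G by fact
  interpret F: subgroup F G by fact
  have F1: "elementary_abelian_subgroup p G ?F"
    by (rule elementary_subgroup[OF eF commutator_stabilizer_subgroup[OF E.subset sF v]])
      (auto simp: commutator_stabilizer_def)
  have E1: "elementary_abelian_subgroup p G ?E"
    by (rule elementary_subgroup[OF eE commutator_stabilizer_subgroup[OF F.subset sE v]])
      (auto simp: commutator_stabilizer_def)
  have comm0: "e0 \<otimes> f0 = f0 \<otimes> e0" using comm e0 f0 by (auto simp: commuting_def)
  have "?F \<noteq> F" using ne e0 f0 by (auto simp: commutator_stabilizer_def)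
  moreover have "?F \<subseteq> F" by (auto simp: commutator_stabilizer_def)
  moreover have w1: "weight ?F = max_weight"
    by (rule commutator_stabilizer_weight[OF eE eF comm v wE wF])
  \<comment> \<open>A proper subgroup of the minimal extremal F that has maximal weight can only be
    trivial, so the maximum is the weight |V| of the trivial group.\<close>
  ultimately have F1_one: "?F = {\<one>}"
    using F F1 unfolding minimal_extremal_def extremal_def by blast
  then have mw: "max_weight = card (carrier V)" using w1 weight_one by simp
  have "act (act v f0 \<ominus>\<^bsub>V\<^esub> v) e0 \<noteq> act v f0 \<ominus>\<^bsub>V\<^esub> v"
    using ne act_commutator_fixed_commute[OF v _ _ comm0] e0 f0 by auto
  then have "?E \<noteq> E" using e0 f0 by (auto simp: commutator_stabilizer_def)
  moreover have "?E \<subseteq> E" by (auto simp: commutator_stabilizer_def)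
  moreover have "weight ?E = max_weight"
    by (rule commutator_stabilizer_weight[OF eF eE commuting_sym[OF comm] v wF wE])
  ultimately have E1_one: "?E = {\<one>}"
    using E E1 unfolding minimal_extremal_def extremal_def by blast
  have "card F * card (fixed E) \<le> card (carrier V)"
    using card_commutator_stabilizer[OF E.subset sF comm v] by (simp add: F1_one E1_one fixed_one)
  moreover have le2: "card E * card (fixed F) \<le> card (carrier V)"
    using card_commutator_stabilizer[OF F.subset sE commuting_sym[OF comm] v]
    by (simp add: F1_one E1_one fixed_one)
  \<comment> \<open>Both numbers are at most |V| and their product is the product of the two
    weights, |V|^2; so each equals |V|, and the injection below is onto V.\<close>
  moreover have "(card F * card (fixed E)) * (card E * card (fixed F))
      = card (carrier V) * card (carrier V)"
    unfolding mw[symmetric] by (rule trans[OF _ arg_cong2[of _ _ _ _ "(*)", OF wE wF]]) (simp add: weight_def ac_simps)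
  ultimately have "card F * card (fixed E) = card (carrier V)"
    using max_weight_pos unfolding mw by (rule nat_factors_eq_if_le)
  moreover have inj: "inj_on (\<lambda>(f, c). (act v f \<ominus>\<^bsub>V\<^esub> v) \<oplus>\<^bsub>V\<^esub> c) (F \<times> fixed E)"
    by (rule commutator_translate_inj[OF E.subset sF comm v F1_one])
  moreover have "(\<lambda>(f, c). (act v f \<ominus>\<^bsub>V\<^esub> v) \<oplus>\<^bsub>V\<^esub> c) ` (F \<times> fixed E) \<subseteq> carrier V"
    using subsetD[OF fixed_subset commutator_translate_in_fixed[OF E.subset F.subset v]] by auto
  ultimately have "(\<lambda>(f, c). (act v f \<ominus>\<^bsub>V\<^esub> v) \<oplus>\<^bsub>V\<^esub> c) ` (F \<times> fixed E) = carrier V"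
    using finite_V by (intro card_subset_eq) (simp_all only: card_image card_cartesian_product)
  then have "\<ominus>\<^bsub>V\<^esub> v \<in> (\<lambda>(f, c). (act v f \<ominus>\<^bsub>V\<^esub> v) \<oplus>\<^bsub>V\<^esub> c) ` (F \<times> fixed E)" using v by simp
  then obtain z where z: "z \<in> F \<times> fixed E"
    and vz: "\<ominus>\<^bsub>V\<^esub> v = (case z of (f, c) \<Rightarrow> (act v f \<ominus>\<^bsub>V\<^esub> v) \<oplus>\<^bsub>V\<^esub> c)"
    by (rule imageE)
  obtain f c where fc: "z = (f, c)" by (cases z)
  have f: "f \<in> F" and c: "c \<in> fixed E" using z fc by simp_all
  have eq: "(act v f \<ominus>\<^bsub>V\<^esub> v) \<oplus>\<^bsub>V\<^esub> c = \<ominus>\<^bsub>V\<^esub> v" using vz fc by simp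
  have cV: "c \<in> carrier V" and fG: "f \<in> carrier G" using c f fixed_subset by auto
  have vf: "act v f = \<ominus>\<^bsub>V\<^esub> c"
  proof -
    have vfV: "act v f \<in> carrier V" using act_closed v fG by simp
    have "act v f = ((act v f \<ominus>\<^bsub>V\<^esub> v) \<oplus>\<^bsub>V\<^esub> c) \<oplus>\<^bsub>V\<^esub> (v \<ominus>\<^bsub>V\<^esub> c)" using vfV v cV by algebra
    also have "\<dots> = \<ominus>\<^bsub>V\<^esub> c" unfolding eq using v cV by algebra
    finally show ?thesis .
  qed
  have e0G: "e0 \<in> carrier G" and f0G: "f0 \<in> carrier G" using e0 f0 by auto
  have "act v e0 = v"
  proof (rule act_inj[OF _ v fG])
    show "act v e0 \<in> carrier V" using act_closed v e0G by simp
    have "act (act v e0) f = act (act v f) e0"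
      using act_commute[OF v e0G fG] comm e0 f unfolding commuting_def by blast
    also have "\<dots> = act v f"
      unfolding vf using c e0 e0G cV by (simp add: act_uminus) (simp add: fixed_space_def)
    finally show "act (act v e0) f = act v f" .
  qed
  then have "act v e0 \<ominus>\<^bsub>V\<^esub> v = \<zero>\<^bsub>V\<^esub>" using v by (simp add: V.M.r_neg V.M.minus_eq)
  then show False using ne act_zero[OF f0G] by simp
qed

end

section \<open>A weakly closed quadratic subgroup\<close>

context group begin

lemma conj_mult: "\<lbrakk>x \<in> carrier G; y \<in> carrier G; g \<in> carrier G\<rbrakk>
    \<Longrightarrow> inv g \<otimes> (x \<otimes> y) \<otimes> g = (inv g \<otimes> x \<otimes> g) \<otimes> (inv g \<otimes> y \<otimes> g)"
  by (simp add: group_simps)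

lemma conj_hom: "g \<in> carrier G \<Longrightarrow> group_hom G G (\<lambda>x. inv g \<otimes> x \<otimes> g)"
  by (simp add: group_hom_def group_hom_axioms_def is_group hom_def conj_mult Pi_iff)

lemma conj_inj: "\<lbrakk>g \<in> carrier G; A \<subseteq> carrier G\<rbrakk> \<Longrightarrow> inj_on (\<lambda>x. inv g \<otimes> x \<otimes> g) A"
  by (auto simp: inj_on_def subset_iff)

lemma inv_commute:
  assumes "x \<in> carrier G" "y \<in> carrier G" "x \<otimes> y = y \<otimes> x"
  shows "inv x \<otimes> y = y \<otimes> inv x"
proof -
  have "inv x \<otimes> y = inv x \<otimes> (y \<otimes> x) \<otimes> inv x" using assms(1,2) by (simp add: m_assoc)
  also have "\<dots> = y \<otimes> inv x"
    unfolding assms(3)[symmetric] using assms(1,2) by (simp add: group_simps)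
  finally show ?thesis .
qed

lemma subgroup_centralizing:
  assumes "B \<subseteq> carrier G"
  shows "subgroup {x \<in> carrier G. \<forall>b\<in>B. x \<otimes> b = b \<otimes> x} G"
proof (rule subgroupI)
  show "{x \<in> carrier G. \<forall>b\<in>B. x \<otimes> b = b \<otimes> x} \<noteq> {}" using assms by (auto simp: subset_iff)
  fix x y assume x: "x \<in> {x \<in> carrier G. \<forall>b\<in>B. x \<otimes> b = b \<otimes> x}"
  show "inv x \<in> {x \<in> carrier G. \<forall>b\<in>B. x \<otimes> b = b \<otimes> x}"
  proof (clarsimp, intro conjI ballI)
    show "inv x \<in> carrier G" using x by simp
    fix b assume b: "b \<in> B"
    then have bG: "b \<in> carrier G" and xG: "x \<in> carrier G" and eq: "x \<otimes> b = b \<otimes> x" using assms x by auto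
    show "inv x \<otimes> b = b \<otimes> inv x" by (rule inv_commute[OF xG bG eq])
  qed
  assume y: "y \<in> {x \<in> carrier G. \<forall>b\<in>B. x \<otimes> b = b \<otimes> x}"
  show "x \<otimes> y \<in> {x \<in> carrier G. \<forall>b\<in>B. x \<otimes> b = b \<otimes> x}"
  proof (clarsimp, intro conjI ballI)
    show "x \<otimes> y \<in> carrier G" using x y by simp
    fix b assume b: "b \<in> B"
    then have bG: "b \<in> carrier G" using assms by auto
    have "x \<otimes> y \<otimes> b = x \<otimes> (b \<otimes> y)" using x y b bG by (simp add: m_assoc)
    also have "\<dots> = b \<otimes> x \<otimes> y" using x y b bG by (simp add: m_assoc[symmetric])
    finally show "x \<otimes> y \<otimes> b = b \<otimes> (x \<otimes> y)" using x y bG by (simp add: m_assoc)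
  qed
qed auto

end

context p_group_module begin

lemma commuting_conj:
  assumes "E \<subseteq> carrier G" "F \<subseteq> carrier G" "commuting E F" "g \<in> carrier G"
  shows "commuting ((\<lambda>x. inv g \<otimes> x \<otimes> g) ` E) ((\<lambda>x. inv g \<otimes> x \<otimes> g) ` F)"
  using assms by (auto simp: commuting_def subset_iff G.conj_mult[symmetric])

lemma elementary_conj:
  assumes E: "elementary_abelian_subgroup p G E" and g: "g \<in> carrier G"
  shows "elementary_abelian_subgroup p G ((\<lambda>x. inv g \<otimes> x \<otimes> g) ` E)"
proof -
  interpret c: group_hom G G "\<lambda>x. inv g \<otimes> x \<otimes> g" by (rule G.conj_hom[OF g])
  have sE: "subgroup E G" and sub: "E \<subseteq> carrier G" and comm: "commuting E E" and pw: "\<forall>x\<in>E. x [^] p = \<one>"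
    using E by (auto simp: elementary_iff dest: subgroup.subset)
  have "(inv g \<otimes> x \<otimes> g) [^] p = \<one>" if "x \<in> E" for x
    using c.hom_nat_pow[of x p] that sub pw g by (auto simp: subset_iff)
  then show ?thesis
    using c.subgroup_img_is_subgroup[OF sE] commuting_conj[OF sub sub comm g]
    by (auto simp: elementary_iff)
qed

lemma fixed_conj:
  assumes E: "E \<subseteq> carrier G" and g: "g \<in> carrier G"
  shows "fixed ((\<lambda>x. inv g \<otimes> x \<otimes> g) ` E) = (\<lambda>v. act v g) ` fixed E"
proof
  show "(\<lambda>v. act v g) ` fixed E \<subseteq> fixed ((\<lambda>x. inv g \<otimes> x \<otimes> g) ` E)"
  proof clarsimp
    fix v assume v: "v \<in> fixed E"
    then have vV: "v \<in> carrier V" using fixed_subset by auto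
    have "act (act v g) (inv g \<otimes> x \<otimes> g) = act v g" if "x \<in> E" for x
      using that v vV E g act_closed by (simp add: act_mult act_inv subset_iff fixed_space_def)
    then show "act v g \<in> fixed ((\<lambda>x. inv g \<otimes> x \<otimes> g) ` E)"
      using act_closed vV g by (simp add: fixed_space_def)
  qed
  show "fixed ((\<lambda>x. inv g \<otimes> x \<otimes> g) ` E) \<subseteq> (\<lambda>v. act v g) ` fixed E"
  proof
    fix v assume v: "v \<in> fixed ((\<lambda>x. inv g \<otimes> x \<otimes> g) ` E)"
    then have vV: "v \<in> carrier V" using fixed_subset by auto
    let ?u = "act v (inv g)"
    have uV: "?u \<in> carrier V" using act_closed vV g by simp
    have "act ?u x = ?u" if x: "x \<in> E" for x
    proof -
      have xG: "x \<in> carrier G" using x E by auto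
      have "act (act ?u x) g = act v (inv g \<otimes> x \<otimes> g)" using vV g xG by (simp add: act_mult act_closed)
      also have "\<dots> = v" using v x by (auto simp: fixed_space_def)
      finally show ?thesis using act_inv(1)[of "act ?u x" g] act_closed[OF uV xG] g by simp
    qed
    then have "?u \<in> fixed E" using uV by (simp add: fixed_space_def)
    moreover have "v = act ?u g" using act_inv vV g by simp
    ultimately show "v \<in> (\<lambda>v. act v g) ` fixed E" by blast
  qed
qed

lemma weight_conj:
  assumes E: "E \<subseteq> carrier G" and g: "g \<in> carrier G"
  shows "weight ((\<lambda>x. inv g \<otimes> x \<otimes> g) ` E) = weight E"
proof -
  have "inj_on (\<lambda>v. act v g) (fixed E)"
    using act_inj g fixed_subset by (meson inj_onI subsetD)
  then show ?thesis
    unfolding weight_def fixed_conj[OF E g] using G.conj_inj[OF g E] by (simp add: card_image)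
qed

lemma extremal_conj:
  assumes E: "extremal E" and g: "g \<in> carrier G"
  shows "extremal ((\<lambda>x. inv g \<otimes> x \<otimes> g) ` E)"
proof -
  have e: "elementary_abelian_subgroup p G E" "E \<noteq> {\<one>}" "weight E = max_weight"
    using E by (auto simp: extremal_def)
  then have sub: "E \<subseteq> carrier G" by (auto simp: elementary_iff dest: subgroup.subset)
  have "(\<lambda>x. inv g \<otimes> x \<otimes> g) ` E \<noteq> {\<one>}"
  proof
    assume "(\<lambda>x. inv g \<otimes> x \<otimes> g) ` E = {\<one>}"
    then have "card E = 1" using card_image[OF G.conj_inj[OF g sub]] by simp
    moreover have "\<one> \<in> E" using e(1) by (auto simp: elementary_iff dest: subgroup.one_closed)
    ultimately show False using e(2) by (metis card_1_singletonE singletonD)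
  qed
  then show ?thesis using elementary_conj[OF e(1) g] weight_conj[OF sub g] e(3) by (simp add: extremal_def)
qed

text \<open>An extremal subgroup inside the conjugate of E is carried back by \<open>inv g\<close>
  to an extremal subgroup inside E.\<close>

lemma minimal_extremal_conj:
  assumes E: "minimal_extremal E" and g: "g \<in> carrier G"
  shows "minimal_extremal ((\<lambda>x. inv g \<otimes> x \<otimes> g) ` E)"
  unfolding minimal_extremal_def
proof (intro conjI allI impI)
  have e: "extremal E" and min: "\<And>F. extremal F \<Longrightarrow> F \<subseteq> E \<Longrightarrow> F = E"
    using E by (auto simp: minimal_extremal_def)
  then have sub: "E \<subseteq> carrier G" by (auto simp: extremal_def elementary_iff dest: subgroup.subset)
  show "extremal ((\<lambda>x. inv g \<otimes> x \<otimes> g) ` E)" by (rule extremal_conj[OF e g])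
  fix F assume F: "extremal F \<and> F \<subseteq> (\<lambda>x. inv g \<otimes> x \<otimes> g) ` E"
  then have sF: "F \<subseteq> carrier G" by (auto simp: extremal_def elementary_iff dest: subgroup.subset)
  let ?F = "(\<lambda>x. inv (inv g) \<otimes> x \<otimes> inv g) ` F"
  have cancel1: "inv (inv g) \<otimes> (inv g \<otimes> x \<otimes> g) \<otimes> inv g = x" if "x \<in> carrier G" for x
    using that g by (simp add: G.group_simps)
  have cancel2: "inv g \<otimes> (inv (inv g) \<otimes> x \<otimes> inv g) \<otimes> g = x" if "x \<in> carrier G" for x
    using that g by (simp add: G.group_simps)
  have "?F \<subseteq> E"
  proof
    fix y assume "y \<in> ?F"
    then obtain x where x: "x \<in> F" "y = inv (inv g) \<otimes> x \<otimes> inv g" by blast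
    obtain e where "e \<in> E" "x = inv g \<otimes> e \<otimes> g" using F x(1) by blast
    then show "y \<in> E" using cancel1 sub x(2) by auto
  qed
  then have FE: "?F = E" using min extremal_conj[of F "inv g"] F g by simp
  show "F = (\<lambda>x. inv g \<otimes> x \<otimes> g) ` E"
    unfolding FE[symmetric] image_image using cancel2 sF by (simp add: subset_iff)
qed

section \<open>Construction of the weakly closed subgroup\<close>

lemma commuting_generate:
  assumes "A \<subseteq> carrier G" "B \<subseteq> carrier G" "commuting A B"
  shows "commuting (generate G A) B"
proof -
  have "generate G A \<subseteq> {x \<in> carrier G. \<forall>b\<in>B. x \<otimes> b = b \<otimes> x}"
    by (rule G.generate_subgroup_incl[OF _ G.subgroup_centralizing[OF assms(2)]])
      (use assms in \<open>auto simp: commuting_def\<close>)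
  then show ?thesis unfolding commuting_def by blast
qed

text \<open>The right argument lies in a pointwise stabilizer, which is a subgroup. The left
  argument has no such description and is reached through \<open>acts_trivially_sym\<close>.\<close>

lemma acts_trivially_generate_right:
  assumes "A \<subseteq> carrier G" "B \<subseteq> carrier G" "acts_trivially A B"
  shows "acts_trivially A (generate G B)"
proof -
  let ?W = "{act v a \<ominus>\<^bsub>V\<^esub> v | v a. v \<in> carrier V \<and> a \<in> A}"
  have "subgroup {f \<in> carrier G. \<forall>w\<in>?W. act w f = w} G"
    by (rule subgroup_stabilizing) (use G.subgroup_self assms(1) act_commutator_closed in auto)
  then have "generate G B \<subseteq> {f \<in> carrier G. \<forall>w\<in>?W. act w f = w}"
    by (rule G.generate_subgroup_incl[rotated]) (use assms in \<open>auto simp: acts_trivially_def\<close>)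
  then show ?thesis by (auto simp: acts_trivially_def)
qed

lemma acts_trivially_sym:
  assumes "A \<subseteq> carrier G" "B \<subseteq> carrier G" "commuting A B" "acts_trivially A B"
  shows "acts_trivially B A"
  unfolding acts_trivially_def
proof (intro ballI)
  fix v e f assume vef: "v \<in> carrier V" "e \<in> B" "f \<in> A"
  then have "act (act v f \<ominus>\<^bsub>V\<^esub> v) e = act v f \<ominus>\<^bsub>V\<^esub> v" "f \<otimes> e = e \<otimes> f"
    using assms(3,4) by (auto simp: acts_trivially_def commuting_def)
  then show "act (act v e \<ominus>\<^bsub>V\<^esub> v) f = act v e \<ominus>\<^bsub>V\<^esub> v"
    using act_commutator_fixed_commute[of v f e] vef assms(1,2) by auto
qed

lemma elementary_generate:
  assumes A: "A \<subseteq> carrier G" and comm: "commuting A A" and pw: "\<And>x. x \<in> A \<Longrightarrow> x [^] p = \<one>"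
  shows "elementary_abelian_subgroup p G (generate G A)"
proof -
  let ?T = "generate G A"
  have sT: "subgroup ?T G" by (rule G.generate_is_subgroup[OF A])
  interpret T: subgroup ?T G by fact
  have "commuting ?T ?T"
    using commuting_generate[OF A T.subset] commuting_generate[OF A A comm] commuting_sym by blast
  then have c: "x \<otimes> y = y \<otimes> x" if "x \<in> ?T" "y \<in> ?T" for x y
    using that by (auto simp: commuting_def)
  have "subgroup {x \<in> ?T. x [^] p = \<one>} G"
  proof (rule G.subgroupI)
    show "{x \<in> ?T. x [^] p = \<one>} \<noteq> {}" using T.one_closed G.nat_pow_one by blast
    fix a b assume a: "a \<in> {x \<in> ?T. x [^] p = \<one>}"
    then show "inv a \<in> {x \<in> ?T. x [^] p = \<one>}" by (simp add: G.nat_pow_inv T.mem_carrier)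
    assume b: "b \<in> {x \<in> ?T. x [^] p = \<one>}"
    show "a \<otimes> b \<in> {x \<in> ?T. x [^] p = \<one>}"
      using a b c G.pow_mult_distrib[of a b p] T.mem_carrier by simp
  qed (use T.subset in auto)
  then have "?T \<subseteq> {x \<in> ?T. x [^] p = \<one>}"
    by (rule G.generate_subgroup_incl[rotated]) (use pw in \<open>auto intro: generate.incl\<close>)
  then show ?thesis using sT \<open>commuting ?T ?T\<close> by (auto simp: elementary_iff)
qed

text \<open>If the maximum is |V|, the given offender attains it; otherwise a maximizer has weight
  different from |V| and so is non-trivial.\<close>

lemma F_module_ex_minimal_extremal:
  assumes "F_module p G V act"
  shows "\<exists>E. minimal_extremal E"
proof -
  obtain E0 where E0: "elementary_abelian_subgroup p G E0" "E0 \<noteq> {\<one>}" "j_value V act E0 \<ge> 1"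
    using assms by (auto simp: F_module_def offender_def)
  have Vpos: "0 < card (carrier V)" using finite_V V.M.zero_closed by (auto simp: card_gt_0_iff)
  have "real (card (carrier V)) \<le> real (weight E0)"
    using E0(3) Vpos by (simp add: j_value_def weight_def field_simps)
  then have w0: "card (carrier V) \<le> weight E0" by simp
  have "\<exists>E. extremal E"
  proof (cases "max_weight = card (carrier V)")
    case True
    then show ?thesis using w0 E0 weight_le[OF E0(1)] by (auto simp: extremal_def)
  next
    case False
    have "max_weight \<in> weight ` {E. elementary_abelian_subgroup p G E}"
      unfolding max_weight_def using finite_elementary E0(1) by (intro Max_in) auto
    then obtain E where E: "elementary_abelian_subgroup p G E" "weight E = max_weight" by auto
    have "E \<noteq> {\<one>}" using E(2) False weight_one by auto
    with E show ?thesis by (auto simp: extremal_def)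
  qed
  moreover have "finite {E. extremal E}"
    by (rule finite_subset[OF _ finite_elementary]) (auto simp: extremal_def)
  ultimately obtain E where "E \<in> {E. extremal E}" "\<And>F. F \<in> {E. extremal E} \<Longrightarrow> F \<le> E \<Longrightarrow> E = F"
    using finite_has_minimal[of "{E. extremal E}"] by auto
  then show ?thesis unfolding minimal_extremal_def by blast
qed

text \<open>Weak closure is the maximality of the family S: if the conjugate of T commutes with T,
  the conjugate of each member of S commutes with all members, so it could be added to S and already
  belongs to it.\<close>

lemma F_module_ex_weakly_closed_quadratic:
  assumes "F_module p G V act"
  shows "\<exists>T. elementary_abelian_subgroup p G T \<and> T \<noteq> {\<one>} \<and> acts_trivially T T \<and>
    (\<forall>g\<in>carrier G. commuting ((\<lambda>x. inv g \<otimes> x \<otimes> g) ` T) T \<longrightarrow> (\<lambda>x. inv g \<otimes> x \<otimes> g) ` T \<subseteq> T)"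
proof -
  obtain E0 where E0: "minimal_extremal E0" using F_module_ex_minimal_extremal[OF assms] by blast
  let ?\<C> = "{S. S \<subseteq> {E. minimal_extremal E} \<and> (\<forall>E\<in>S. \<forall>F\<in>S. commuting E F)}"
  have el: "elementary_abelian_subgroup p G E" if "minimal_extremal E" for E
    using that by (auto simp: minimal_extremal_def extremal_def)
  have sub: "E \<subseteq> carrier G" if "minimal_extremal E" for E
    using el[OF that] by (auto simp: elementary_iff dest: subgroup.subset)
  have self: "commuting E E" if "minimal_extremal E" for E
    using el[OF that] by (auto simp: elementary_iff)
  have "finite {E. minimal_extremal E}"
    by (rule finite_subset[OF _ finite_elementary]) (use el in auto)
  then have fin: "finite ?\<C>" by simp
  have "{E0} \<in> ?\<C>" using E0 self by simp
  from finite_has_maximal2[OF fin this] obtain S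
    where S: "S \<in> ?\<C>" "{E0} \<subseteq> S" and max: "\<forall>S'\<in>?\<C>. S \<subseteq> S' \<longrightarrow> S = S'"
    by (elim bexE conjE)
  have Smax: "S = S'" if "S' \<in> ?\<C>" "S \<subseteq> S'" for S' using max that by simp
  define T where "T = generate G (\<Union>S)"
  have US: "\<Union>S \<subseteq> carrier G" using S(1) sub by auto
  have cU: "commuting (\<Union>S) (\<Union>S)"
    using S(1) unfolding commuting_def by blast
  have pw: "x [^] p = \<one>" if "x \<in> \<Union>S" for x using that S(1) el by (auto simp: elementary_iff)
  have Tel: "elementary_abelian_subgroup p G T" unfolding T_def
    by (rule elementary_generate[OF US cU pw])
  then have Ts: "T \<subseteq> carrier G" and cT: "commuting T T" and sT: "subgroup T G"
    by (auto simp: elementary_iff dest: subgroup.subset)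
  have E0T: "E \<subseteq> T" if "E \<in> S" for E unfolding T_def using that by (auto intro: generate.incl)
  have Tne: "T \<noteq> {\<one>}"
  proof
    assume "T = {\<one>}"
    then have "E0 \<subseteq> {\<one>}" using E0T S(2) by auto
    moreover have "\<one> \<in> E0" using el[OF E0] by (auto simp: elementary_iff dest: subgroup.one_closed)
    ultimately show False using E0 by (auto simp: minimal_extremal_def extremal_def)
  qed
  \<comment> \<open>The case E = F is included and makes every single member quadratic.\<close>
  have "acts_trivially E F" if "E \<in> S" "F \<in> S" for E F
    using minimal_extremal_acts_trivially that S(1) by blast
  then have "acts_trivially (\<Union>S) (\<Union>S)" unfolding acts_trivially_def by blast
  then have "acts_trivially (\<Union>S) T" unfolding T_def by (rule acts_trivially_generate_right[OF US US])
  moreover have "commuting (\<Union>S) T"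
    using cT E0T unfolding commuting_def by blast
  ultimately have "acts_trivially T (\<Union>S)" by (intro acts_trivially_sym[OF US Ts])
  then have Tq: "acts_trivially T T"
    using acts_trivially_generate_right[OF Ts US] by (simp add: T_def)
  have "(\<lambda>x. inv g \<otimes> x \<otimes> g) ` T \<subseteq> T"
    if g: "g \<in> carrier G" and comm: "commuting ((\<lambda>x. inv g \<otimes> x \<otimes> g) ` T) T" for g
  proof -
    have conjS: "(\<lambda>x. inv g \<otimes> x \<otimes> g) ` E \<in> S" if E: "E \<in> S" for E
    proof -
      let ?E = "(\<lambda>x. inv g \<otimes> x \<otimes> g) ` E"
      have m: "minimal_extremal ?E" using minimal_extremal_conj g E S(1) by blast
      have "commuting ?E F" if "F \<in> S" for F
        using comm E0T[OF E] E0T[OF that] unfolding commuting_def by blast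
      then have "insert ?E S \<in> ?\<C>" using S(1) m self[OF m] commuting_sym by auto
      then show ?thesis using Smax[of "insert ?E S"] by auto
    qed
    interpret c: group_hom G G "\<lambda>x. inv g \<otimes> x \<otimes> g" by (rule G.conj_hom[OF g])
    have "subgroup {x \<in> carrier G. inv g \<otimes> x \<otimes> g \<in> T} G"
    proof -
      interpret T: subgroup T G by fact
      show ?thesis
      proof (rule G.subgroupI)
        show "{x \<in> carrier G. inv g \<otimes> x \<otimes> g \<in> T} \<noteq> {}"
          using T.one_closed c.hom_one by (metis (mono_tags, lifting) G.one_closed empty_iff mem_Collect_eq)
        fix a b assume a: "a \<in> {x \<in> carrier G. inv g \<otimes> x \<otimes> g \<in> T}"
        then show "inv a \<in> {x \<in> carrier G. inv g \<otimes> x \<otimes> g \<in> T}" using T.m_inv_closed by auto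
        assume b: "b \<in> {x \<in> carrier G. inv g \<otimes> x \<otimes> g \<in> T}"
        show "a \<otimes> b \<in> {x \<in> carrier G. inv g \<otimes> x \<otimes> g \<in> T}" using a b G.conj_mult g by simp
      qed auto
    qed
    moreover have "\<Union>S \<subseteq> {x \<in> carrier G. inv g \<otimes> x \<otimes> g \<in> T}"
      using conjS E0T US by blast
    ultimately have "T \<subseteq> {x \<in> carrier G. inv g \<otimes> x \<otimes> g \<in> T}"
      unfolding T_def by (intro G.generate_subgroup_incl)
    then show ?thesis by blast
  qed
  then show ?thesis using Tel Tne Tq by blast
qed

end

section \<open>Quadratic commutators\<close>

context p_group_module begin

lemma acts_trivially_singleton_iff:
  assumes "x \<in> carrier G"
  shows "acts_trivially {x} {x} \<longleftrightarrow>
    (\<forall>v\<in>carrier V. act v (x \<otimes> x) \<oplus>\<^bsub>V\<^esub> v = act v x \<oplus>\<^bsub>V\<^esub> act v x)"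
  using assms by (simp add: acts_trivially_def act_commutator_fixed_iff act_mult)

lemma quadratic_iff:
  assumes g: "g \<in> carrier G"
  shows "quadratic G V act g \<longleftrightarrow> g \<noteq> \<one> \<and> acts_trivially {g} {g}"
proof -
  \<comment> \<open>An image equals \<open>{z}\<close> only if it is non-empty; the zero vector
    provides the element.\<close>
  have img: "f ` S = {z} \<longleftrightarrow> (\<forall>a\<in>S. f a = z)" if "a0 \<in> S"
    for f :: "'v \<Rightarrow> 'v" and S z a0
    using that by auto
  have "act_commutator_space V act (act_commutator_space V act (carrier V) g) g
      = (\<lambda>v. act (act v g \<ominus>\<^bsub>V\<^esub> v) g \<ominus>\<^bsub>V\<^esub> (act v g \<ominus>\<^bsub>V\<^esub> v)) ` carrier V"
    by (auto simp: act_commutator_space_def act_commutator_def)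
  also have "\<dots> = {\<zero>\<^bsub>V\<^esub>} \<longleftrightarrow>
      (\<forall>v\<in>carrier V. act (act v g \<ominus>\<^bsub>V\<^esub> v) g \<ominus>\<^bsub>V\<^esub> (act v g \<ominus>\<^bsub>V\<^esub> v) = \<zero>\<^bsub>V\<^esub>)"
    by (rule img[OF V.M.zero_closed])
  also have "\<dots> \<longleftrightarrow> acts_trivially {g} {g}"
    using g act_closed by (simp add: acts_trivially_def V.M.minus_eq_zero_iff)
  finally show ?thesis using g by (auto simp: quadratic_def)
qed

text \<open>The relation for \<open>x\<close> at the vector v * g^-1 becomes, after applying g, the
  relation for the conjugate at v.\<close>

lemma acts_trivially_conj:
  assumes x: "x \<in> carrier G" and g: "g \<in> carrier G" and q: "acts_trivially {x} {x}"
  shows "acts_trivially {inv g \<otimes> x \<otimes> g} {inv g \<otimes> x \<otimes> g}"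
proof -
  let ?y = "inv g \<otimes> x \<otimes> g"
  have "act v (?y \<otimes> ?y) \<oplus>\<^bsub>V\<^esub> v = act v ?y \<oplus>\<^bsub>V\<^esub> act v ?y" if v: "v \<in> carrier V" for v
  proof -
    let ?u = "act v (inv g)"
    have u: "?u \<in> carrier V" using act_closed v g by simp
    have "act (act ?u (x \<otimes> x) \<oplus>\<^bsub>V\<^esub> ?u) g = act (act ?u x \<oplus>\<^bsub>V\<^esub> act ?u x) g"
      using q u acts_trivially_singleton_iff[OF x] by simp
    then have "act ?u (x \<otimes> x \<otimes> g) \<oplus>\<^bsub>V\<^esub> v = act ?u (x \<otimes> g) \<oplus>\<^bsub>V\<^esub> act ?u (x \<otimes> g)"
      using u x g v by (simp add: act_add act_closed act_mult[symmetric] act_inv act_one G.m_assoc)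
    moreover have "act ?u (x \<otimes> x \<otimes> g) = act v (?y \<otimes> ?y)" "act ?u (x \<otimes> g) = act v ?y"
      using v x g by (simp_all add: act_mult[symmetric] G.group_simps)
    ultimately show ?thesis by simp
  qed
  then show ?thesis using acts_trivially_singleton_iff[of ?y] x g by simp
qed

lemma double_eq_zero:
  assumes "odd p" "w \<in> carrier V" "w \<oplus>\<^bsub>V\<^esub> w = \<zero>\<^bsub>V\<^esub>"
  shows "w = \<zero>\<^bsub>V\<^esub>"
proof -
  have p2: "2 < p" using prime_p assms(1) by (metis dvd_refl le_neq_implies_less prime_ge_2_nat)
  obtain k where "p = 2 * k + 1" using assms(1) by (rule oddE)
  \<comment> \<open>\<open>c\<close> is (p + 1) / 2, the inverse of 2 in the prime field.\<close>
  then obtain c where c: "2 * c = int p + 1" using that[of "int k + 1"] by simp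
  have cR: "c \<in> carrier (residue_ring (int p))" using c p2 by (simp add: residue_ring_def)
  have cc: "c \<oplus>\<^bsub>residue_ring (int p)\<^esub> c = \<one>\<^bsub>residue_ring (int p)\<^esub>"
  proof -
    have "(c + c) mod int p = 1" using c p2 by (simp add: mult_2[symmetric])
    then show ?thesis by (simp add: residue_ring_def)
  qed
  have "w = (c \<oplus>\<^bsub>residue_ring (int p)\<^esub> c) \<odot>\<^bsub>V\<^esub> w" using assms(2) cc by (simp add: V.smult_one)
  also have "\<dots> = c \<odot>\<^bsub>V\<^esub> (w \<oplus>\<^bsub>V\<^esub> w)"
    using cR assms(2) by (simp add: V.smult_l_distr V.smult_r_distr)
  also have "\<dots> = \<zero>\<^bsub>V\<^esub>" using cR assms(3) by (simp add: V.smult_r_null)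
  finally show ?thesis .
qed

text \<open>The power of g with exponent |G| is the identity and, |G| being odd, sends w to
  -w.\<close>

lemma act_eq_uminus_imp_zero:
  assumes "odd p" and w: "w \<in> carrier V" and g: "g \<in> carrier G" and eq: "act w g = \<ominus>\<^bsub>V\<^esub> w"
  shows "w = \<zero>\<^bsub>V\<^esub>"
proof -
  have pow: "act w (g [^] n) = (if even n then w else \<ominus>\<^bsub>V\<^esub> w)" for n :: nat
    by (induction n) (use w g eq in \<open>simp_all add: act_one act_mult act_uminus\<close>)
  have "odd (order G)" using order_eq assms(1) by auto
  then have "w = \<ominus>\<^bsub>V\<^esub> w" using pow[of "order G"] G.pow_order_eq_1[OF g] act_one[OF w] by simp
  then have "w \<oplus>\<^bsub>V\<^esub> w = \<zero>\<^bsub>V\<^esub>" using w V.M.r_neg by metis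
  then show ?thesis using double_eq_zero assms(1) w by blast
qed

text \<open>Since \<open>A\<close>, \<open>A C\<close> and \<open>A C\<^sup>-\<^sup>1\<close> are all conjugate to \<open>A\<close>, comparing the three
  quadratic relations eliminates \<open>A\<close> and leaves \<open>(C - 1)\<^sup>2 (C + 1) = 0\<close>;
  here \<open>C + 1\<close> is injective because \<open>C\<close> has odd order.\<close>

lemma acts_trivially_group_commutator:
  assumes "odd p" and A: "A \<in> carrier G" and B: "B \<in> carrier G" and qA: "acts_trivially {A} {A}"
    and AC: "group_commutator G A B \<otimes> A = A \<otimes> group_commutator G A B"
    and BC: "group_commutator G A B \<otimes> B = B \<otimes> group_commutator G A B"
  shows "acts_trivially {group_commutator G A B} {group_commutator G A B}"
proof -
  let ?C = "group_commutator G A B"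
  let ?D = "A \<otimes> inv ?C"
  have C: "?C \<in> carrier G" using A B by (simp add: group_commutator_def)
  have conj1: "inv B \<otimes> A \<otimes> B = A \<otimes> ?C" using A B by (simp add: group_commutator_def G.group_simps)
  have "inv (inv B) \<otimes> A \<otimes> inv B = ?D"
  proof -
    have "A \<otimes> B = B \<otimes> A \<otimes> ?C" using A B by (simp add: group_commutator_def G.group_simps)
    then have AB: "A \<otimes> B \<otimes> inv ?C = B \<otimes> A" using A B C by (simp add: G.m_assoc)
    have "B \<otimes> A \<otimes> inv B = A \<otimes> (B \<otimes> inv ?C) \<otimes> inv B"
      unfolding AB[symmetric] using A B C by (simp add: G.m_assoc)
    also have "\<dots> = ?D"
      unfolding G.inv_commute[OF C B BC, symmetric] using A B C by (simp add: G.m_assoc)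
    finally show ?thesis using B by simp
  qed
  then have qD: "acts_trivially {?D} {?D}"
    using acts_trivially_conj[OF A _ qA, of "inv B"] B by simp
  have qAC: "acts_trivially {A \<otimes> ?C} {A \<otimes> ?C}"
    using acts_trivially_conj[OF A B qA] conj1 by simp
  \<comment> \<open>The quadratic relation of x, taken at v * h. With h = C^2, 1, C^3, C the right
    sides become 2R, 2S, 2R, 2S, so adding the first to the fourth and the third to the second
    cancels P and Q.\<close>
  have q: "act v (h \<otimes> (x \<otimes> x)) \<oplus>\<^bsub>V\<^esub> act v h = act v (h \<otimes> x) \<oplus>\<^bsub>V\<^esub> act v (h \<otimes> x)"
    if "acts_trivially {x} {x}" "x \<in> carrier G" "h \<in> carrier G" "v \<in> carrier V" for x h v
    using that acts_trivially_singleton_iff[of x] act_closed by (simp add: act_mult)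
  have CA: "?C \<otimes> (A \<otimes> x) = A \<otimes> (?C \<otimes> x)" if "x \<in> carrier G" for x
    using AC that A C by (simp add: G.m_assoc[symmetric])
  show ?thesis
    unfolding acts_trivially_def
  proof (simp, intro ballI)
    fix v assume v: "v \<in> carrier V"
    define P Q R S where "P = act v (A \<otimes> (A \<otimes> (?C \<otimes> ?C)))" and "Q = act v (A \<otimes> (A \<otimes> ?C))"
      and "R = act v (A \<otimes> (?C \<otimes> ?C))" and "S = act v (A \<otimes> ?C)"
    define c1 c2 c3 where "c1 = act v ?C" and "c2 = act c1 ?C" and "c3 = act c2 ?C"
    have cl: "P \<in> carrier V" "Q \<in> carrier V" "R \<in> carrier V" "S \<in> carrier V"
      "c1 \<in> carrier V" "c2 \<in> carrier V" "c3 \<in> carrier V"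
      using v A C act_closed by (simp_all add: P_def Q_def R_def S_def c1_def c2_def c3_def)
    have c2: "c2 = act v (?C \<otimes> ?C)" and c3: "c3 = act v (?C \<otimes> (?C \<otimes> ?C))"
      using v C by (simp_all add: c1_def c2_def c3_def act_mult act_closed)
    have 1: "P \<oplus>\<^bsub>V\<^esub> c2 = R \<oplus>\<^bsub>V\<^esub> R"
      using q[OF qA A _ v, of "?C \<otimes> ?C"] A C by (simp add: P_def R_def c2 G.m_assoc CA AC)
    have 2: "P \<oplus>\<^bsub>V\<^esub> v = S \<oplus>\<^bsub>V\<^esub> S"
      using q[OF qAC _ _ v, of \<one>] A C v by (simp add: P_def S_def G.m_assoc CA AC act_one)
    have D1: "?C \<otimes> (?C \<otimes> ?C) \<otimes> ?D = A \<otimes> (?C \<otimes> ?C)"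
      using A C by (simp add: G.m_assoc CA AC)
    have D2: "?C \<otimes> (?C \<otimes> ?C) \<otimes> (?D \<otimes> ?D) = A \<otimes> (A \<otimes> ?C)"
      using A C by (simp add: G.group_simps CA AC)
    have 3: "Q \<oplus>\<^bsub>V\<^esub> c3 = R \<oplus>\<^bsub>V\<^esub> R"
      using q[OF qD _ _ v, of "?C \<otimes> (?C \<otimes> ?C)"] A C unfolding D1 D2 by (simp add: Q_def R_def c3)
    have 4: "Q \<oplus>\<^bsub>V\<^esub> c1 = S \<oplus>\<^bsub>V\<^esub> S"
      using q[OF qA A C v] A C by (simp add: Q_def S_def c1_def CA AC)
    have "(P \<oplus>\<^bsub>V\<^esub> Q) \<oplus>\<^bsub>V\<^esub> (c2 \<oplus>\<^bsub>V\<^esub> c1) = (P \<oplus>\<^bsub>V\<^esub> c2) \<oplus>\<^bsub>V\<^esub> (Q \<oplus>\<^bsub>V\<^esub> c1)" using cl by algebra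
    also have "\<dots> = (Q \<oplus>\<^bsub>V\<^esub> c3) \<oplus>\<^bsub>V\<^esub> (P \<oplus>\<^bsub>V\<^esub> v)" unfolding 1 2 3 4 ..
    also have "\<dots> = (P \<oplus>\<^bsub>V\<^esub> Q) \<oplus>\<^bsub>V\<^esub> (c3 \<oplus>\<^bsub>V\<^esub> v)" using cl v by algebra
    finally have sum: "c2 \<oplus>\<^bsub>V\<^esub> c1 = c3 \<oplus>\<^bsub>V\<^esub> v" using cl v by simp
    \<comment> \<open>w is v * (C - 1)^2; the relation just found says w * (C + 1) = 0.\<close>
    define w where "w = (c2 \<ominus>\<^bsub>V\<^esub> c1) \<ominus>\<^bsub>V\<^esub> (c1 \<ominus>\<^bsub>V\<^esub> v)"
    have wV: "w \<in> carrier V" using cl v by (simp add: w_def)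
    have "act w ?C = (c3 \<ominus>\<^bsub>V\<^esub> c2) \<ominus>\<^bsub>V\<^esub> (c2 \<ominus>\<^bsub>V\<^esub> c1)"
      using cl v C by (simp add: w_def act_minus c1_def[symmetric] c2_def[symmetric] c3_def[symmetric])
    also have "\<dots> = \<ominus>\<^bsub>V\<^esub> w \<oplus>\<^bsub>V\<^esub> ((c3 \<oplus>\<^bsub>V\<^esub> v) \<ominus>\<^bsub>V\<^esub> (c2 \<oplus>\<^bsub>V\<^esub> c1))"
      unfolding w_def using cl v by algebra
    also have "\<dots> = \<ominus>\<^bsub>V\<^esub> w" unfolding sum using cl v wV by (simp add: V.M.r_neg V.M.minus_eq)
    finally have "w = \<zero>\<^bsub>V\<^esub>" using act_eq_uminus_imp_zero assms(1) wV C by blast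
    then have "c2 \<ominus>\<^bsub>V\<^esub> c1 = c1 \<ominus>\<^bsub>V\<^esub> v" using cl v by (simp add: w_def V.M.minus_eq_zero_iff)
    then show "act (act v ?C \<ominus>\<^bsub>V\<^esub> v) ?C = act v ?C \<ominus>\<^bsub>V\<^esub> v"
      using cl v C by (simp add: act_minus c1_def[symmetric] c2_def[symmetric])
  qed
qed

end

section \<open>Commutator identities and the lower central series\<close>

lemma (in group) group_commutator_closed:
  "\<lbrakk>x \<in> carrier G; y \<in> carrier G\<rbrakk> \<Longrightarrow> group_commutator G x y \<in> carrier G"
  by (simp add: group_commutator_def)

lemma (in group) conj_eq_mult_commutator:
  "\<lbrakk>x \<in> carrier G; y \<in> carrier G\<rbrakk> \<Longrightarrow> inv y \<otimes> x \<otimes> y = x \<otimes> group_commutator G x y"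
  by (simp add: group_commutator_def group_simps)

lemma (in group) inv_group_commutator:
  "\<lbrakk>x \<in> carrier G; y \<in> carrier G\<rbrakk> \<Longrightarrow> inv (group_commutator G x y) = group_commutator G y x"
  by (simp add: group_commutator_def group_simps)

lemma (in group) group_commutator_eq_one_iff:
  assumes "x \<in> carrier G" "y \<in> carrier G"
  shows "group_commutator G x y = \<one> \<longleftrightarrow> x \<otimes> y = y \<otimes> x"
proof -
  have "x \<otimes> y = y \<otimes> x \<otimes> group_commutator G x y"
    using assms by (simp add: group_commutator_def group_simps)
  moreover have "y \<otimes> x \<otimes> group_commutator G x y = y \<otimes> x \<otimes> \<one> \<longleftrightarrow> group_commutator G x y = \<one>"
    using assms group_commutator_closed[OF assms] by (subst l_cancel) simp_all
  ultimately show ?thesis using assms by simp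
qed

lemma (in group) lower_central_subgroup: "subgroup (lower_central G n) G"
proof (induction n)
  case (Suc n)
  have "{group_commutator G x y | x y. x \<in> lower_central G n \<and> y \<in> carrier G} \<subseteq> carrier G"
    using subgroup.subset[OF Suc] group_commutator_closed by auto
  then show ?case by (simp add: generate_is_subgroup)
qed (simp add: subgroup_self)

lemma (in group) group_commutator_lower_central:
  assumes "x \<in> lower_central G n" "y \<in> carrier G"
  shows "group_commutator G x y \<in> lower_central G (Suc n)"
    and "group_commutator G y x \<in> lower_central G (Suc n)"
proof -
  show 1: "group_commutator G x y \<in> lower_central G (Suc n)"
    using assms by (auto intro: generate.incl)
  have "x \<in> carrier G" using assms(1) subgroup.subset[OF lower_central_subgroup] by blast
  then show "group_commutator G y x \<in> lower_central G (Suc n)"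
    using subgroup.m_inv_closed[OF lower_central_subgroup 1] inv_group_commutator[of x y] assms(2)
    by simp
qed

lemma (in group) group_commutator_in_derived:
  assumes "x \<in> carrier G" "y \<in> carrier G"
  shows "group_commutator G x y \<in> derived G (carrier G)"
  unfolding derived_def
proof (rule generate.incl)
  \<comment> \<open>\<open>derived_set\<close> collects the products h k h^-1 k^-1, so the present
    convention corresponds to the inverses of x and y.\<close>
  have "group_commutator G x y = inv x \<otimes> inv y \<otimes> inv (inv x) \<otimes> inv (inv y)"
    using assms by (simp add: group_commutator_def)
  then show "group_commutator G x y \<in> derived_set G (carrier G)" using assms by blast
qed

section \<open>Class at most four and metabelian groups\<close>

text \<open>The situation to be refuted: T comes from the assumption that V is an F-module, and
  \<open>no_central_quadratic\<close> states the hypothesis for the generators of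
  Omega_1(Z(G)).\<close>

locale weakly_closed_quadratic = p_group_module +
  fixes T :: "'a set"
  assumes odd_p: "odd p"
    and T_elementary: "elementary_abelian_subgroup p G T" and T_nontrivial: "T \<noteq> {\<one>}"
    and T_quadratic: "acts_trivially T T"
    and T_weakly_closed: "\<And>g. \<lbrakk>g \<in> carrier G; commuting ((\<lambda>x. inv g \<otimes> x \<otimes> g) ` T) T\<rbrakk>
      \<Longrightarrow> (\<lambda>x. inv g \<otimes> x \<otimes> g) ` T \<subseteq> T"
    and no_central_quadratic: "\<And>z. \<lbrakk>z \<in> center G; z [^] p = \<one>; acts_trivially {z} {z}\<rbrakk> \<Longrightarrow> z = \<one>"
begin

sublocale T: subgroup T G using T_elementary by (simp add: elementary_iff)

lemma T_commute: "\<lbrakk>x \<in> T; y \<in> T\<rbrakk> \<Longrightarrow> x \<otimes> y = y \<otimes> x"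
  using T_elementary by (simp add: elementary_iff commuting_def)

lemma T_pow: "x \<in> T \<Longrightarrow> x [^] p = \<one>"
  using T_elementary by (simp add: elementary_iff)

lemma T_acts_trivially: "x \<in> T \<Longrightarrow> acts_trivially {x} {x}"
  using T_quadratic by (simp add: acts_trivially_def)

lemma T_central: "\<lbrakk>x \<in> T; x \<in> center G\<rbrakk> \<Longrightarrow> x = \<one>"
  using no_central_quadratic T_pow T_acts_trivially by blast

text \<open>Since a^g = a [a, g] and T is abelian, the conjugate of T commutes with T as soon as the
  commutators do; weak closure then applies.\<close>

lemma commutator_in_T:
  assumes g: "g \<in> carrier G" and comm: "\<And>a x. \<lbrakk>a \<in> T; x \<in> T\<rbrakk>
      \<Longrightarrow> group_commutator G a g \<otimes> x = x \<otimes> group_commutator G a g"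
    and a: "a \<in> T"
  shows "inv g \<otimes> a \<otimes> g \<in> T" and "group_commutator G a g \<in> T"
proof -
  have "commuting ((\<lambda>x. inv g \<otimes> x \<otimes> g) ` T) T"
    unfolding commuting_def
  proof clarify
    fix x y assume x: "x \<in> T" and y: "y \<in> T"
    let ?c = "group_commutator G x g"
    have c: "?c \<in> carrier G" using x g G.group_commutator_closed by auto
    have "x \<otimes> ?c \<otimes> y = x \<otimes> (y \<otimes> ?c)" using c x y comm[OF x y] by (simp add: G.m_assoc)
    also have "\<dots> = y \<otimes> (x \<otimes> ?c)"
      using c x y T_commute[OF x y] by (simp add: G.m_assoc[symmetric])
    finally show "inv g \<otimes> x \<otimes> g \<otimes> y = y \<otimes> (inv g \<otimes> x \<otimes> g)"
      using G.conj_eq_mult_commutator[of x g] x g by simp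
  qed
  then show 1: "inv g \<otimes> a \<otimes> g \<in> T" using T_weakly_closed[OF g] a by blast
  have "group_commutator G a g = inv a \<otimes> (inv g \<otimes> a \<otimes> g)"
    using a g by (simp add: group_commutator_def G.m_assoc)
  then show "group_commutator G a g \<in> T" using 1 a by simp
qed

text \<open>The set \<open>K\<close> is the normal core of T. If non-trivial, it would contain a
  non-trivial central element of G, which lies in T and is therefore quadratic of order p.\<close>

lemma all_conj_in_T_imp_one:
  assumes y: "y \<in> carrier G" and conj: "\<And>g. g \<in> carrier G \<Longrightarrow> inv g \<otimes> y \<otimes> g \<in> T"
  shows "y = \<one>"
proof (rule ccontr)
  assume "y \<noteq> \<one>"
  define K where "K = {x \<in> carrier G. \<forall>g\<in>carrier G. inv g \<otimes> x \<otimes> g \<in> T}"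
  have sK: "subgroup K G"
  proof (rule G.subgroupI)
    show "K \<noteq> {}" using y conj by (auto simp: K_def)
    fix a b assume a: "a \<in> K"
    have "inv g \<otimes> inv a \<otimes> g \<in> T" if g: "g \<in> carrier G" for g
    proof -
      have "inv (inv g \<otimes> a \<otimes> g) \<in> T" using a g by (simp add: K_def)
      moreover have "inv (inv g \<otimes> a \<otimes> g) = inv g \<otimes> inv a \<otimes> g"
        using a g by (simp add: K_def G.group_simps)
      ultimately show ?thesis by simp
    qed
    then show "inv a \<in> K" using a by (simp add: K_def)
    assume b: "b \<in> K"
    show "a \<otimes> b \<in> K" using a b by (simp add: K_def G.conj_mult)
  qed (auto simp: K_def)
  have K: "K \<lhd> G"
    unfolding G.normal_inv_iff
  proof (intro conjI ballI sK)
    fix x h assume x: "x \<in> carrier G" and h: "h \<in> K"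
    have "inv g \<otimes> (x \<otimes> h \<otimes> inv x) \<otimes> g \<in> T" if g: "g \<in> carrier G" for g
    proof -
      have "inv (inv x \<otimes> g) \<otimes> h \<otimes> (inv x \<otimes> g) \<in> T" using h x g by (simp add: K_def)
      moreover have "inv (inv x \<otimes> g) \<otimes> h \<otimes> (inv x \<otimes> g) = inv g \<otimes> (x \<otimes> h \<otimes> inv x) \<otimes> g"
        using x g h by (simp add: K_def G.group_simps)
      ultimately show ?thesis by simp
    qed
    then show "x \<otimes> h \<otimes> inv x \<in> K" using x h by (simp add: K_def)
  qed
  obtain n where n: "order G = p ^ n" using order_eq by (rule exE)
  have "{\<one>} \<subset> K" using y conj \<open>y \<noteq> \<one>\<close> subgroup.one_closed[OF sK] by (auto simp: K_def)
  from G.finite_p_group_ex_central_mod[OF prime_p n finite_G G.one_is_normal K this]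
  obtain b where b': "b \<in> K - {\<one>}" "\<forall>g\<in>carrier G. inv b \<otimes> (inv g \<otimes> b \<otimes> g) \<in> {\<one>}"
    by (rule bexE)
  have b: "b \<in> K" "b \<noteq> \<one>" using b'(1) by simp_all
  have fixb: "inv b \<otimes> (inv g \<otimes> b \<otimes> g) = \<one>" if "g \<in> carrier G" for g using b'(2) that by simp
  have bG: "b \<in> carrier G" using b by (simp add: K_def)
  have "b \<otimes> g = g \<otimes> b" if "g \<in> carrier G" for g
    using fixb[OF that] G.group_commutator_eq_one_iff[OF bG that] bG that
    by (simp add: group_commutator_def G.m_assoc)
  then have "b \<in> center G" using bG by (simp add: center_def)
  moreover have "b \<in> T"
  proof -
    have "inv \<one> \<otimes> b \<otimes> \<one> \<in> T" using b(1) G.one_closed unfolding K_def by blast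
    then show ?thesis using bG by simp
  qed
  ultimately show False using T_central b(2) by blast
qed

text \<open>Under this hypothesis weak closure makes T normal, so T equals its core.\<close>

lemma not_centralizing_commutators:
  assumes comm: "\<And>a g x. \<lbrakk>a \<in> T; g \<in> carrier G; x \<in> T\<rbrakk>
      \<Longrightarrow> group_commutator G a g \<otimes> x = x \<otimes> group_commutator G a g"
  shows False
proof -
  obtain y where y: "y \<in> T" "y \<noteq> \<one>" using T_nontrivial T.one_closed by blast
  have "inv g \<otimes> y \<otimes> g \<in> T" if "g \<in> carrier G" for g
    using commutator_in_T(1)[OF that comm[OF _ that] y(1)] .
  then show False using all_conj_in_T_imp_one[of y] y by auto
qed

text \<open>The commutator c has order dividing p because a and a^b = a c do and c commutes with a;
  it is quadratic because a is.\<close>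

lemma central_commutator_eq_one:
  assumes a: "a \<in> T" and b: "b \<in> carrier G" and c: "group_commutator G a b \<in> center G"
  shows "group_commutator G a b = \<one>"
proof (rule no_central_quadratic[OF c])
  let ?c = "group_commutator G a b"
  have aG: "a \<in> carrier G" using a by simp
  have cG: "?c \<in> carrier G" and cent: "\<And>g. g \<in> carrier G \<Longrightarrow> ?c \<otimes> g = g \<otimes> ?c"
    using c by (auto simp: center_def)
  show "acts_trivially {?c} {?c}"
    by (rule acts_trivially_group_commutator[OF odd_p aG b T_acts_trivially[OF a] cent[OF aG] cent[OF b]])
  interpret h: group_hom G G "\<lambda>x. inv b \<otimes> x \<otimes> b" by (rule G.conj_hom[OF b])
  have "(a \<otimes> ?c) [^] p = \<one>"
    using h.hom_nat_pow[OF aG, of p] T_pow[OF a] G.conj_eq_mult_commutator[OF aG b] b by simp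
  moreover have "(a \<otimes> ?c) [^] p = a [^] p \<otimes> ?c [^] p"
    by (rule G.pow_mult_distrib[OF cent[OF aG, symmetric] aG cG])
  ultimately show "?c [^] p = \<one>" using T_pow[OF a] cG by simp
qed

text \<open>Write L_i for the usual lower central series, so that L_4 is central. Then [T, L_3] lies
  in L_4 and vanishes. So commutators [a, b] with b in L_2, lying in L_3, centralize T and fall into
  T; their commutators with G are in L_4, hence trivial, so they are central and trivial too. Thus T
  commutes with L_2, which contains [T, G].\<close>

lemma not_class_at_most_four: "\<not> nilpotence_class_at_most G 4"
proof
  assume "nilpotence_class_at_most G 4"
  then have triv: "lower_central G (Suc (Suc (Suc (Suc 0)))) = {\<one>}"
    by (simp add: nilpotence_class_at_most_def numeral_eq_Suc)
  have lcG: "x \<in> carrier G" if "x \<in> lower_central G n" for x n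
    using that subgroup.subset[OF G.lower_central_subgroup] by blast
  have cent: "x \<in> center G" if x: "x \<in> lower_central G (Suc (Suc (Suc 0)))" for x
  proof -
    have "group_commutator G x g = \<one>" if "g \<in> carrier G" for g
      using G.group_commutator_lower_central(1)[OF x that] triv by blast
    then show ?thesis using G.group_commutator_eq_one_iff lcG[OF x] by (auto simp: center_def)
  qed
  have comm3: "b \<otimes> a = a \<otimes> b" if b: "b \<in> lower_central G (Suc (Suc 0))" and a: "a \<in> T" for a b
    using central_commutator_eq_one[OF a lcG[OF b] cent[OF G.group_commutator_lower_central(2)[OF b]]]
      G.group_commutator_eq_one_iff[of a b] a lcG[OF b] by simp
  have comm2: "b \<otimes> a = a \<otimes> b" if b: "b \<in> lower_central G (Suc 0)" and a: "a \<in> T" for a b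
  proof -
    let ?c = "group_commutator G a b"
    have c3: "?c \<in> lower_central G (Suc (Suc 0))"
      using G.group_commutator_lower_central(2)[OF b] a by simp
    have cT: "?c \<in> T"
      by (rule commutator_in_T(2)[OF lcG[OF b] _ a], rule comm3)
        (use G.group_commutator_lower_central(2)[OF b] in auto)
    have "group_commutator G ?c g = \<one>" if g: "g \<in> carrier G" for g
      by (rule central_commutator_eq_one[OF cT g cent[OF G.group_commutator_lower_central(1)[OF c3 g]]])
    then have "?c \<in> center G"
      using G.group_commutator_eq_one_iff[of ?c] lcG[OF c3] by (auto simp: center_def)
    then have "?c = \<one>" using T_central cT by blast
    then show ?thesis using G.group_commutator_eq_one_iff[of a b] a lcG[OF b] by simp
  qed
  show False
  proof (rule not_centralizing_commutators)
    fix a g x assume "a \<in> T" "g \<in> carrier G" "x \<in> T"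
    then show "group_commutator G a g \<otimes> x = x \<otimes> group_commutator G a g"
      using G.group_commutator_lower_central(1)[of a 0 g] by (intro comm2) auto
  qed
qed

text \<open>As \<open>G/G'\<close> acts on the abelian group \<open>G'\<close> and is itself abelian, \<open>C = C\<^bsub>G'\<^esub>(T)\<close> is normal and
  \<open>[a, b]\<^sup>g = [a, b\<^sup>g]\<close> for \<open>b \<in> G'\<close>; so if \<open>b\<close> is central modulo \<open>C\<close>, then weak closure
  puts all conjugates of \<open>[a, b]\<close> into \<open>T\<close>.\<close>

lemma not_metabelian: "\<not> metabelian G"
proof
  assume met: "metabelian G"
  define P where "P = derived G (carrier G)"
  have nP: "P \<lhd> G" unfolding P_def by (rule G.derived_self_is_normal)
  interpret P: normal P G by fact
  have cP: "x \<otimes> y = y \<otimes> x" if "x \<in> P" "y \<in> P" for x y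
  proof -
    interpret comm_group "G\<lparr>carrier := P\<rparr>" using met by (simp add: metabelian_def P_def)
    show ?thesis using m_comm that by simp
  qed
  have comP: "group_commutator G x y \<in> P" if "x \<in> carrier G" "y \<in> carrier G" for x y
    unfolding P_def by (rule G.group_commutator_in_derived[OF that])
  have PG: "x \<in> carrier G" if "x \<in> P" for x using that by (rule P.mem_carrier)
  have conjP: "inv g \<otimes> x \<otimes> g \<in> P" if "x \<in> P" "g \<in> carrier G" for x g
    using P.inv_op_closed1 that by simp
  \<comment> \<open>xy and yx differ by an element of G', which acts trivially on the abelian group
    G' by conjugation.\<close>
  have swap: "inv (x \<otimes> y) \<otimes> b \<otimes> (x \<otimes> y) = inv (y \<otimes> x) \<otimes> b \<otimes> (y \<otimes> x)"
    if b: "b \<in> P" and x: "x \<in> carrier G" and y: "y \<in> carrier G" for b x y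
  proof -
    let ?b = "inv (y \<otimes> x) \<otimes> b \<otimes> (y \<otimes> x)" and ?c = "group_commutator G x y"
    have bP: "?b \<in> P" using conjP[OF b, of "y \<otimes> x"] x y by simp
    have c: "?c \<in> P" by (rule comP[OF x y])
    have xy: "x \<otimes> y = y \<otimes> x \<otimes> ?c" using x y by (simp add: group_commutator_def G.group_simps)
    have "inv (x \<otimes> y) \<otimes> b \<otimes> (x \<otimes> y) = inv ?c \<otimes> (?b \<otimes> ?c)"
      unfolding xy using x y PG[OF b] PG[OF c] by (simp add: G.group_simps)
    also have "\<dots> = ?b"
      unfolding cP[OF bP c] using PG[OF bP] PG[OF c] by (rule G.inv_mult_cancel[rotated])
    finally show ?thesis .
  qed
  have conj_commutator: "inv g \<otimes> group_commutator G a b \<otimes> g = group_commutator G a (inv g \<otimes> b \<otimes> g)"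
    if a: "a \<in> carrier G" and b: "b \<in> P" and g: "g \<in> carrier G" for a b g
  proof -
    have ib: "inv b \<in> P" using b by simp
    have bG: "b \<in> carrier G" by (rule PG[OF b])
    \<comment> \<open>Written as the conjugate of b^-1 by ag times b^g, the left side lets
      \<open>swap\<close> replace ag by ga.\<close>
    have "inv g \<otimes> group_commutator G a b \<otimes> g = (inv (a \<otimes> g) \<otimes> inv b \<otimes> (a \<otimes> g)) \<otimes> (inv g \<otimes> b \<otimes> g)"
      using a bG g by (simp add: group_commutator_def G.group_simps)
    also have "\<dots> = (inv (g \<otimes> a) \<otimes> inv b \<otimes> (g \<otimes> a)) \<otimes> (inv g \<otimes> b \<otimes> g)"
      unfolding swap[OF ib a g] ..
    also have "\<dots> = group_commutator G a (inv g \<otimes> b \<otimes> g)"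
      using a bG g by (simp add: group_commutator_def G.group_simps)
    finally show ?thesis .
  qed
  define C where "C = {b \<in> P. \<forall>a\<in>T. b \<otimes> a = a \<otimes> b}"
  have sC: "subgroup C G"
  proof -
    have "C = P \<inter> {x \<in> carrier G. \<forall>a\<in>T. x \<otimes> a = a \<otimes> x}" using PG by (auto simp: C_def)
    then show ?thesis
      using G.subgroups_Inter_pair[OF P.subgroup_axioms G.subgroup_centralizing[OF T.subset]] by simp
  qed
  have conjC: "inv g \<otimes> b \<otimes> g \<in> C" if b: "b \<in> C" and g: "g \<in> carrier G" for b g
  proof -
    have bP: "b \<in> P" and bG: "b \<in> carrier G" using b PG by (auto simp: C_def)
    have bg: "inv g \<otimes> b \<otimes> g \<in> P" by (rule conjP[OF bP g])
    have "(inv g \<otimes> b \<otimes> g) \<otimes> a = a \<otimes> (inv g \<otimes> b \<otimes> g)" if a: "a \<in> T" for a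
    proof -
      have aG: "a \<in> carrier G" using a by simp
      have "group_commutator G a b = \<one>"
        using G.group_commutator_eq_one_iff[OF aG bG] b a by (simp add: C_def)
      then have "group_commutator G a (inv g \<otimes> b \<otimes> g) = \<one>"
        using conj_commutator[OF aG bP g] g by simp
      then show ?thesis using G.group_commutator_eq_one_iff[OF aG PG[OF bg]] by simp
    qed
    then show ?thesis using bg by (simp add: C_def)
  qed
  have nC: "C \<lhd> G"
    unfolding G.normal_inv_iff
  proof (intro conjI ballI sC)
    fix x h assume "x \<in> carrier G" "h \<in> C"
    then show "x \<otimes> h \<otimes> inv x \<in> C" using conjC[of h "inv x"] by simp
  qed
  obtain n where n: "order G = p ^ n" using order_eq by (rule exE)
  have CP: "C \<subseteq> P" by (auto simp: C_def)
  have "C \<noteq> P"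
  proof
    assume "C = P"
    then have "group_commutator G a g \<otimes> x = x \<otimes> group_commutator G a g"
      if "a \<in> T" "g \<in> carrier G" "x \<in> T" for a g x
      using comP[of a g] that by (auto simp: C_def)
    then show False by (rule not_centralizing_commutators)
  qed
  then have "C \<subset> P" using CP by simp
  from G.finite_p_group_ex_central_mod[OF prime_p n finite_G nC nP this]
  obtain b where b': "b \<in> P - C" "\<forall>g\<in>carrier G. inv b \<otimes> (inv g \<otimes> b \<otimes> g) \<in> C"
    by (rule bexE)
  have b: "b \<in> P" "b \<notin> C" using b'(1) by simp_all
  have bC: "inv b \<otimes> (inv g \<otimes> b \<otimes> g) \<in> C" if "g \<in> carrier G" for g using b'(2) that by simp
  have bG: "b \<in> carrier G" by (rule PG[OF b(1)])
  obtain a where a: "a \<in> T" "b \<otimes> a \<noteq> a \<otimes> b" using b by (auto simp: C_def)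
  have aG: "a \<in> carrier G" using a(1) by simp
  have "inv g \<otimes> group_commutator G a b \<otimes> g \<in> T" if g: "g \<in> carrier G" for g
  proof -
    let ?b = "inv g \<otimes> b \<otimes> g"
    have bgG: "?b \<in> carrier G" using bG g by simp
    have "group_commutator G x ?b \<in> C" if x: "x \<in> T" for x
    proof -
      have xG: "x \<in> carrier G" using x by simp
      have "group_commutator G b x \<in> C" using bC[OF xG] bG xG by (simp add: group_commutator_def G.m_assoc)
      then have "group_commutator G x b \<in> C"
        using subgroup.m_inv_closed[OF sC] G.inv_group_commutator[OF bG xG] by fastforce
      then show ?thesis using conjC g conj_commutator[OF xG b(1) g] by fastforce
    qed
    \<comment> \<open>Weak closure is used with the conjugate of \<open>b\<close> as the conjugating
      element: its commutators with T lie in C and so centralize T.\<close>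
    then have "group_commutator G a ?b \<in> T"
      by (intro commutator_in_T(2)[OF bgG _ a(1)]) (simp add: C_def)
    then show ?thesis using conj_commutator[OF aG b(1) g] by simp
  qed
  then have "group_commutator G a b = \<one>"
    by (rule all_conj_in_T_imp_one[OF G.group_commutator_closed[OF aG bG]])
  then show False using G.group_commutator_eq_one_iff[OF aG bG] a(2) by simp
qed

end

theorem theorem1p2:
  fixes p :: nat
    and G :: "('g, 'a) monoid_scheme"
    and V :: "(int, 'v, 'b) module_scheme"
    and act :: "'v \<Rightarrow> 'g \<Rightarrow> 'v"
  assumes "Factorial_Ring.prime p" and "odd p"
    and "finite_p_group p G"
    and "FpG_module p G V act"
    and "faithful G V act"
    and "\<not> (\<exists>g \<in> Omega1_center p G. quadratic G V act g)"
    and "nilpotence_class_at_most G 4 \<or> metabelian G"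
  shows "\<not> F_module p G V act"
proof
  assume F: "F_module p G V act"
  have "finite (carrier V)"
  \<comment> \<open>For infinite V the cardinality is 0 by convention, and division by 0 gives
    \<open>j_value\<close> 0, so no subgroup could be an offender.\<close>
  proof (rule ccontr)
    assume "infinite (carrier V)"
    then show False using F by (auto simp: F_module_def offender_def j_value_def)
  qed
  then interpret p_group_module p G V act
    using assms by (simp add: p_group_module_def p_group_module_axioms_def)
  obtain T where T: "elementary_abelian_subgroup p G T" "T \<noteq> {\<one>\<^bsub>G\<^esub>}" "acts_trivially T T"
    "\<And>g. g \<in> carrier G \<Longrightarrow> commuting ((\<lambda>x. inv\<^bsub>G\<^esub> g \<otimes>\<^bsub>G\<^esub> x \<otimes>\<^bsub>G\<^esub> g) ` T) T \<Longrightarrow>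
      (\<lambda>x. inv\<^bsub>G\<^esub> g \<otimes>\<^bsub>G\<^esub> x \<otimes>\<^bsub>G\<^esub> g) ` T \<subseteq> T"
    using F_module_ex_weakly_closed_quadratic[OF F] by blast
  interpret weakly_closed_quadratic p G V act T
  proof unfold_locales
    fix z assume z: "z \<in> center G" "z [^]\<^bsub>G\<^esub> p = \<one>\<^bsub>G\<^esub>" "acts_trivially {z} {z}"
    have zG: "z \<in> carrier G" using z(1) by (simp add: center_def)
    have "z \<in> Omega1_center p G"
      unfolding Omega1_center_def using z(1,2) G.pow_eq_id[OF zG] by (intro generate.incl) simp
    then show "z = \<one>\<^bsub>G\<^esub>" using assms(6) quadratic_iff[OF zG] z(3) by blast
  qed (use assms(2) T in auto)
  show False using assms(7) not_class_at_most_four not_metabelian by blast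
qed

end
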